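(* Let $\mathbb{F}$ be an infinite field of characteristic two and let $\mathrm{gl}_2$ be the Lie algebra of all $2\times 2$ matrices over $\mathbb{F}$. Then the T-ideal $T[\mathrm{gl}_2]$ of all polynomial identities for $\mathrm{gl}_2$ in the free Lie algebra $\mathcal{L}(X)$ over $\mathbb{F}$ is generated, as a T-ideal, by the following elements: (a) $(x_1x_2)(x_3x_4)x_5$; (b) $(x_1x_2)(x_1x_2\cdots x_k)$ for all integers $k>2$; (c) $(x_1x_2)(x_3x_4)+(x_1x_3)(x_2x_4)+(x_1x_4)(x_2x_3)$; (d) $(x_1x_2)(x_3x_4x_5\cdots x_m)+(x_1x_3)(x_2x_4x_5\cdots x_m)+(x_1x_4)(x_2x_3x_5\cdots x_m)$ for all integers $m>4$.
   Context: The Lie bracket is written as juxtaposition, so in $\mathrm{gl}_2$ the product $AB$ denotes the commutator $[A,B]=A\cdot B-B\cdot A$. A product without parentheses is left-normalized: $x_1x_2\cdots x_n=(\cdots((x_1x_2)x_3)\cdots)x_n$. Thus, for example, $(x_1x_2)(x_3x_4)x_5=[[[x_1,x_2],[x_3,x_4]],x_5]$. $\mathcal{L}(X)$ is the free Lie algebra over $\mathbb{F}$ freely generated by $x_1,x_2,\ldots$ (countably many generators). An element $f=f(x_1,\ldots,x_k)\in\mathcal{L}(X)$ is a polynomial identity for a Lie algebra $\mathcal{L}$ if $f(a_1,\ldots,a_k)=0$ for all $a_1,\ldots,a_k\in\mathcal{L}$; $T[\mathcal{L}]$ is the ideal of all polynomial identities for $\mathcal{L}$. A T-ideal is an ideal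 of $\mathcal{L}(X)$ stable under all substitutions $x_1\to g_1,\ x_2\to g_2,\ldots$ with $g_1,g_2,\ldots\in\mathcal{L}(X)$. The T-ideal generated by a set is the smallest T-ideal containing it. *)

theory Defs
  imports "HOL-Analysis.Analysis"
begin

section \<open>Lie algebras over a field\<close>

locale lie_algebra = vector_space scale
  for scale :: "'f::field \<Rightarrow> 'b::ab_group_add \<Rightarrow> 'b" +
  fixes br :: "'b \<Rightarrow> 'b \<Rightarrow> 'b"
  assumes br_add_left: "br (a + b) c = br a c + br b c"
    and br_add_right: "br a (b + c) = br a b + br a c"
    and br_scale_left: "br (scale r a) b = scale r (br a b)"
    and br_scale_right: "br a (scale r b) = scale r (br a b)"
    and br_self: "br a a = 0"
    and jacobi: "br a (br b c) + br b (br c a) + br c (br a b) = 0"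
begin

definition lie_ideal :: "'b set \<Rightarrow> bool" where
  "lie_ideal I \<longleftrightarrow> subspace I \<and> (\<forall>a\<in>I. \<forall>b. br a b \<in> I \<and> br b a \<in> I)"

text \<open>The left-normalized product of a nonempty list.\<close>

definition lprod :: "'b list \<Rightarrow> 'b" where
  "lprod as = foldl br (hd as) (tl as)"

end

definition lie_hom ::
  "('f \<Rightarrow> 'b \<Rightarrow> 'b) \<Rightarrow> ('b \<Rightarrow> 'b \<Rightarrow> 'b) \<Rightarrow>
   ('f \<Rightarrow> 'c \<Rightarrow> 'c) \<Rightarrow> ('c \<Rightarrow> 'c \<Rightarrow> 'c) \<Rightarrow>
   ('b::ab_group_add \<Rightarrow> 'c::ab_group_add) \<Rightarrow> bool" where
  "lie_hom s1 br1 s2 br2 h \<longleftrightarrow>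
     (\<forall>a b. h (a + b) = h a + h b) \<and>
     (\<forall>r a. h (s1 r a) = s2 r (h a)) \<and>
     (\<forall>a b. h (br1 a b) = br2 (h a) (h b))"

section \<open>The free Lie algebra on countably many generators\<close>

text \<open>
  The free Lie algebra is the algebra of formal terms modulo the smallest congruence
  that validates the axioms of a Lie algebra.
\<close>

datatype 'f lterm =
    TGen nat
  | TZero
  | TAdd "'f lterm" "'f lterm"
  | TScale 'f "'f lterm"
  | TBr "'f lterm" "'f lterm"

inductive lie_eq :: "'f::field lterm \<Rightarrow> 'f lterm \<Rightarrow> bool" where
  refl: "lie_eq s s"
| sym: "lie_eq s t \<Longrightarrow> lie_eq t s"
| trans: "lie_eq s t \<Longrightarrow> lie_eq t u \<Longrightarrow> lie_eq s u"
| cong_add: "lie_eq s s' \<Longrightarrow> lie_eq t t' \<Longrightarrow> lie_eq (TAdd s t) (TAdd s' t')"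
| cong_scale: "lie_eq s s' \<Longrightarrow> lie_eq (TScale r s) (TScale r s')"
| cong_br: "lie_eq s s' \<Longrightarrow> lie_eq t t' \<Longrightarrow> lie_eq (TBr s t) (TBr s' t')"
| add_assoc: "lie_eq (TAdd (TAdd s t) u) (TAdd s (TAdd t u))"
| add_comm: "lie_eq (TAdd s t) (TAdd t s)"
| add_zero: "lie_eq (TAdd TZero s) s"
| add_neg: "lie_eq (TAdd (TScale (- 1) s) s) TZero"
| scale_add_right: "lie_eq (TScale r (TAdd s t)) (TAdd (TScale r s) (TScale r t))"
| scale_add_left: "lie_eq (TScale (q + r) s) (TAdd (TScale q s) (TScale r s))"
| scale_scale: "lie_eq (TScale q (TScale r s)) (TScale (q * r) s)"
| scale_one: "lie_eq (TScale 1 s) s"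
| br_add_left: "lie_eq (TBr (TAdd s t) u) (TAdd (TBr s u) (TBr t u))"
| br_add_right: "lie_eq (TBr s (TAdd t u)) (TAdd (TBr s t) (TBr s u))"
| br_scale_left: "lie_eq (TBr (TScale r s) t) (TScale r (TBr s t))"
| br_scale_right: "lie_eq (TBr s (TScale r t)) (TScale r (TBr s t))"
| br_self: "lie_eq (TBr s s) TZero"
| jacobi: "lie_eq (TAdd (TAdd (TBr s (TBr t u)) (TBr t (TBr u s))) (TBr u (TBr s t))) TZero"

quotient_type (overloaded) 'f free_lie = "'f::field lterm" / lie_eq
  by (intro equivpI reflpI sympI transpI) (blast intro: lie_eq.intros)+

instantiation free_lie :: (field) ab_group_add
begin

lift_definition zero_free_lie :: "'a free_lie" is TZero .

lift_definition plus_free_lie :: "'a free_lie \<Rightarrow> 'a free_lie \<Rightarrow> 'a free_lie" is TAdd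
  by (rule lie_eq.cong_add)

lift_definition uminus_free_lie :: "'a free_lie \<Rightarrow> 'a free_lie" is "TScale (- 1)"
  by (rule lie_eq.cong_scale)

definition minus_free_lie :: "'a free_lie \<Rightarrow> 'a free_lie \<Rightarrow> 'a free_lie" where
  "minus_free_lie a b = a + - b"

instance
proof
  fix a b c :: "'a free_lie"
  show "a + b + c = a + (b + c)" by transfer (rule lie_eq.add_assoc)
  show "a + b = b + a" by transfer (rule lie_eq.add_comm)
  show "0 + a = a" by transfer (rule lie_eq.add_zero)
  show "- a + a = 0" by transfer (rule lie_eq.add_neg)
  show "a - b = a + - b" by (rule minus_free_lie_def)
qed

end

lift_definition fscale :: "'f::field \<Rightarrow> 'f free_lie \<Rightarrow> 'f free_lie" is TScale
  by (rule lie_eq.cong_scale)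

lift_definition fbr :: "'f::field free_lie \<Rightarrow> 'f free_lie \<Rightarrow> 'f free_lie" (infixl \<open>\<odot>\<close> 70) is TBr
  by (rule lie_eq.cong_br)

text \<open>
  The generators are numbered \<open>x\<^sub>1, x\<^sub>2, \<dots>\<close>, so the term \<open>TGen i\<close>
  represents \<open>x\<^sub>i\<^sub>+\<^sub>1\<close>. The value at index 0 is meaningless.
\<close>

lift_definition gen :: "nat \<Rightarrow> 'f::field free_lie" is "\<lambda>i. TGen (i - 1)" .

global_interpretation free: lie_algebra fscale "fbr :: 'f::field free_lie \<Rightarrow> _"
proof
  fix q r :: 'f and a b c :: "'f free_lie"
  show "fscale r (a + b) = fscale r a + fscale r b" by transfer (rule lie_eq.scale_add_right)
  show "fscale (q + r) a = fscale q a + fscale r a" by transfer (rule lie_eq.scale_add_left)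
  show "fscale q (fscale r a) = fscale (q * r) a" by transfer (rule lie_eq.scale_scale)
  show "fscale 1 a = a" by transfer (rule lie_eq.scale_one)
  show "(a + b) \<odot> c = a \<odot> c + b \<odot> c" by transfer (rule lie_eq.br_add_left)
  show "a \<odot> (b + c) = a \<odot> b + a \<odot> c" by transfer (rule lie_eq.br_add_right)
  show "fscale r a \<odot> b = fscale r (a \<odot> b)" by transfer (rule lie_eq.br_scale_left)
  show "a \<odot> fscale r b = fscale r (a \<odot> b)" by transfer (rule lie_eq.br_scale_right)
  show "a \<odot> a = 0" by transfer (rule lie_eq.br_self)
  show "a \<odot> (b \<odot> c) + b \<odot> (c \<odot> a) + c \<odot> (a \<odot> b) = 0" by transfer (rule lie_eq.jacobi)
qed

section \<open>Evaluation and polynomial identities\<close>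

context lie_algebra
begin

primrec term_eval :: "(nat \<Rightarrow> 'b) \<Rightarrow> 'f lterm \<Rightarrow> 'b" where
  "term_eval v (TGen i) = v (Suc i)"
| "term_eval v TZero = 0"
| "term_eval v (TAdd s t) = term_eval v s + term_eval v t"
| "term_eval v (TScale r s) = scale r (term_eval v s)"
| "term_eval v (TBr s t) = br (term_eval v s) (term_eval v t)"

lemma term_eval_cong: "lie_eq s t \<Longrightarrow> term_eval v s = term_eval v t"
proof (induction rule: lie_eq.induct)
  case (add_comm s t)
  show ?case by (simp add: add.commute)
qed (simp_all add: br_add_left br_add_right br_scale_left br_scale_right br_self jacobi
      scale_right_distrib scale_left_distrib add.assoc[symmetric])

text \<open>
  \<open>eval v f\<close> is the value \<open>f(v 1, v 2, \<dots>)\<close>; it does not depend on the chosen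
  representative, and \<open>eval v\<close> is the unique Lie homomorphism sending each
  \<open>gen i\<close> with \<open>i \<ge> 1\<close> to \<open>v i\<close>.
\<close>

definition eval :: "(nat \<Rightarrow> 'b) \<Rightarrow> 'f free_lie \<Rightarrow> 'b" where
  "eval v f = term_eval v (rep_free_lie f)"

lemma eval_abs [simp]: "eval v (abs_free_lie t) = term_eval v t"
  unfolding eval_def
  by (rule term_eval_cong) (metis Quotient_free_lie Quotient_rel_rep free_lie.abs_eq_iff Quotient_abs_rep)

lemma eval_gen: "i \<ge> 1 \<Longrightarrow> eval v (gen i) = v i"
  by (simp add: gen.abs_eq)

lemma lie_hom_eval: "lie_hom fscale fbr scale br (eval v)"
proof -
  have "eval v (a + b) = eval v a + eval v b" for a b
    by (induction a; induction b) (simp add: plus_free_lie.abs_eq)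
  moreover have "eval v (fscale r a) = scale r (eval v a)" for r a
    by (induction a) (simp add: fscale.abs_eq)
  moreover have "eval v (a \<odot> b) = br (eval v a) (eval v b)" for a b
    by (induction a; induction b) (simp add: fbr.abs_eq)
  ultimately show ?thesis by (simp add: lie_hom_def)
qed

lemma eval_unique:
  assumes h: "lie_hom fscale fbr scale br h" and v: "\<And>i. i \<ge> 1 \<Longrightarrow> h (gen i) = v i"
  shows "h = eval v"
proof
  fix f
  have "h (abs_free_lie t) = term_eval v t" for t
  proof (induction t)
    case (TGen i)
    then show ?case using v[of "Suc i"] by (simp add: gen.abs_eq)
  next
    case TZero
    have "h 0 = h 0 + h 0" using h unfolding lie_hom_def by (metis add.right_neutral)
    then show ?case by (simp add: zero_free_lie.abs_eq[symmetric])
  qed (use h in \<open>simp_all add: lie_hom_def plus_free_lie.abs_eq[symmetric]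
        fscale.abs_eq[symmetric] fbr.abs_eq[symmetric]\<close>)
  then show "h f = eval v f" by (induction f) simp
qed

definition identities :: "'f free_lie set" where
  "identities = {f. \<forall>v. eval v f = 0}"

end

section \<open>T-ideals\<close>

text \<open>\<open>free.eval g\<close> is the substitution \<open>gen i \<mapsto> g i\<close>.\<close>

definition T_ideal :: "'f::field free_lie set \<Rightarrow> bool" where
  "T_ideal I \<longleftrightarrow> free.lie_ideal I \<and> (\<forall>g. \<forall>f\<in>I. free.eval g f \<in> I)"

lemma T_ideal_hull: "T_ideal (T_ideal hull S)"
  by (rule hull_in) (auto simp: T_ideal_def free.lie_ideal_def free.subspace_def)

section \<open>The Lie algebra of 2 by 2 matrices\<close>

definition mscale :: "'f::field \<Rightarrow> 'f^2^2 \<Rightarrow> 'f^2^2" where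
  "mscale r A = (\<chi> i j. r * A $ i $ j)"

definition commutator :: "'f::field^2^2 \<Rightarrow> 'f^2^2 \<Rightarrow> 'f^2^2" where
  "commutator A B = A ** B - B ** A"

global_interpretation gl2: lie_algebra mscale "commutator :: 'f::field^2^2 \<Rightarrow> _"
  by unfold_locales
     (simp_all add: mscale_def commutator_def matrix_matrix_mult_def vec_eq_iff sum_2 algebra_simps)

end

theory Submission
  imports Defs
begin

text \<open>
  In characteristic two the units \<open>h = E\<^sub>1\<^sub>1\<close>, \<open>e = E\<^sub>1\<^sub>2\<close>, \<open>f = E\<^sub>2\<^sub>1\<close> and the identity matrix \<open>z\<close> satisfy
  \<open>[h,e] = e\<close>, \<open>[h,f] = f\<close> and \<open>[e,f] = z\<close> with \<open>z\<close> central. Modulo (a)--(d), tails commute, the product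
  \<open>(x\<^sub>i x\<^sub>j)(x\<^sub>k x\<^sub>l x\<^sub>t\<dots>)\<close> depends only on the multiset of its tail letters and is an alternating form in
  the brackets \<open>x\<^sub>i x\<^sub>j\<close> and \<open>x\<^sub>k x\<^sub>l\<close>; the Jacobi identity and (c), (d) then move chosen letters into the
  two brackets. The resulting normal words are separated by \<open>gl\<^sub>2\<close>: at
  \<open>x\<^sub>i = a\<^sub>i h + b\<^sub>i e + c\<^sub>i f\<close> a word of multidegree \<open>d\<close> contributes multiples of \<open>a\<^sup>d b\<^sub>p / a\<^sub>p\<close> to the
  coefficient of \<open>e\<close>, and of \<open>a\<^sup>d (b\<^sub>p c\<^sub>q + b\<^sub>q c\<^sub>p) / (a\<^sub>p a\<^sub>q)\<close> to that of \<open>z\<close>, and over an infinite field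
  monomials are linearly independent.
\<close>

section \<open>Lie algebras satisfying the basis\<close>

context lie_algebra
begin

lemma br_zero_left [simp]: "br 0 x = 0"
  using br_add_left[of 0 0 x] by simp

lemma br_zero_right [simp]: "br x 0 = 0"
  using br_add_right[of x 0 0] by simp

end

text \<open>Models of (a)--(d) in characteristic two, with tails \<open>xs\<close> of any length:
  \<open>derived2_central\<close> is (a), \<open>alternating\<close> is (b) together with the
  trivial empty tail, and \<open>exchange\<close> merges (c), the empty tail, with (d). Both
  \<open>gl2\<close> and the relatively free algebra are instances.\<close>

locale gl2_like = lie_algebra scale br
  for scale :: "'f::field \<Rightarrow> 'b::ab_group_add \<Rightarrow> 'b" and br :: "'b \<Rightarrow> 'b \<Rightarrow> 'b" +
  assumes add_self: "(x::'b) + x = 0"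
    and derived2_central: "br (br (br a b) (br c d)) e = 0"
    and alternating: "br (br a b) (foldl br (br a b) xs) = 0"
    and exchange: "br (br a b) (foldl br (br c d) xs) + br (br a c) (foldl br (br b d) xs)
      + br (br a d) (foldl br (br b c) xs) = 0"
begin

section \<open>Arithmetic and the Jacobi identity in characteristic two\<close>

lemma uminus_id: "- x = (x::'b)"
  using add_self[of x] by (simp add: eq_neg_iff_add_eq_0 [symmetric])

lemma minus_eq_plus: "x - y = x + (y::'b)"
  using uminus_id[of y] by (metis diff_conv_add_uminus)

lemma add_eq_0_iff_eq: "x + y = 0 \<longleftrightarrow> x = (y::'b)"
  by (metis eq_neg_iff_add_eq_0 uminus_id)

lemma br_commute: "br a b = br b a"
proof -
  have "br (a + b) (a + b) = 0" by (rule br_self)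
  then have "br a b + br b a = 0"
    unfolding br_add_left br_add_right by (simp add: br_self add.commute)
  then show ?thesis by (simp add: add_eq_0_iff_eq)
qed

lemma jacobi_right: "br (br a b) c = br (br a c) b + br a (br b c)"
proof -
  have "br (br a b) c + (br (br a c) b + br a (br b c)) = 0"
    using jacobi[of a b c] by (simp add: br_commute add_ac)
  then show ?thesis by (simp add: add_eq_0_iff_eq)
qed

lemma jacobi_cyclic: "br (br a b) c = br (br a c) b + br (br b c) a"
  using jacobi_right by (metis br_commute)

section \<open>Rearranging the tail of a product\<close>

lemma foldl_br_add: "foldl br (x + y) xs = foldl br x xs + foldl br y xs"
  by (induction xs arbitrary: x y) (simp_all add: br_add_left)

lemma foldl_br_zero [simp]: "foldl br 0 xs = 0"
  by (induction xs) simp_all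

lemma foldl_br_bracket: "\<exists>a' b'. foldl br (br a b) xs = br a' b'"
  by (cases xs rule: rev_cases) auto

lemma foldl_br_derived2: "xs \<noteq> [] \<Longrightarrow> foldl br (br (br a b) (br c d)) xs = 0"
  by (cases xs) (simp_all add: derived2_central)

text \<open>By the Jacobi identity, exchanging the first two tail letters costs an element of the
  second derived algebra, followed by the remaining tail.\<close>

lemma foldl_swap:
  "foldl br (br a b) (s # t # xs) + foldl br (br a b) (t # s # xs) = foldl br (br (br a b) (br s t)) xs"
proof -
  have "br (br (br a b) s) t + br (br (br a b) t) s = br (br a b) (br s t)"
    by (subst jacobi_right) (simp add: add_ac add_self minus_eq_plus flip: diff_eq_eq)
  then show ?thesis by (simp flip: foldl_br_add)
qed

text \<open>The error term of \<open>foldl_swap\<close> vanishes by (a) if letters follow; otherwise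
  it is central and the outer bracket kills it.\<close>

lemma bracket_foldl_swap:
  "br (br p q) (foldl br (br a b) (s # t # xs)) = br (br p q) (foldl br (br a b) (t # s # xs))"
proof -
  have "br (br p q) (foldl br (br (br a b) (br s t)) xs) = 0"
    by (cases "xs = []") (simp_all add: foldl_br_derived2 derived2_central br_commute[of "br p q"])
  then show ?thesis
    by (metis foldl_swap br_add_right add_eq_0_iff_eq)
qed

lemma bracket_foldl_move:
  "br (br p q) (foldl br (br a b) (xs @ s # ys)) = br (br p q) (foldl br (br a b) (s # xs @ ys))"
proof (induction xs arbitrary: a b)
  case (Cons x xs)
  have "br (br p q) (foldl br (br a b) ((x # xs) @ s # ys))
      = br (br p q) (foldl br (br a b) (x # s # xs @ ys))"
    using Cons.IH[of "br a b" x] by simp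
  also have "\<dots> = br (br p q) (foldl br (br a b) (s # x # xs @ ys))"
    by (rule bracket_foldl_swap)
  finally show ?case by simp
qed simp

lemma bracket_foldl_perm:
  "mset xs = mset ys \<Longrightarrow> br (br p q) (foldl br (br a b) xs) = br (br p q) (foldl br (br a b) ys)"
proof (induction xs arbitrary: a b ys)
  case (Cons x xs)
  then have "x \<in> set ys" by (metis list.set_intros(1) mset_eq_setD)
  then obtain us vs where ys: "ys = us @ x # vs" by (auto dest: split_list)
  with Cons.prems have "mset xs = mset (us @ vs)" by simp
  from Cons.IH[OF this, of "br a b" x] show ?case
    using bracket_foldl_move[of p q a b us x vs] by (simp add: ys)
qed simp

text \<open>Bracketing with \<open>s\<close> is a derivation and annihilates the central element
  \<open>br (br a b) (br c d)\<close>, so \<open>s\<close> can change sides.\<close>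

lemma shift: "br (br (br a b) s) (br c d) = br (br a b) (br (br c d) s)"
proof -
  have "0 = br (br (br a b) (br c d)) s" by (simp add: derived2_central)
  also have "\<dots> = br (br (br a b) s) (br c d) + br (br a b) (br (br c d) s)"
    by (rule jacobi_right)
  finally show ?thesis by (simp add: add_eq_0_iff_eq)
qed

text \<open>\<open>shift\<close> carries the tail across letter by letter; the order in which the
  letters arrive is corrected by \<open>bracket_foldl_perm\<close>.\<close>

lemma bracket_foldl_commute:
  "br (br a b) (foldl br (br c d) xs) = br (br c d) (foldl br (br a b) xs)"
proof (induction xs arbitrary: c d)
  case Nil
  show ?case by (simp add: br_commute)
next
  case (Cons x xs)
  obtain a' b' where f: "foldl br (br a b) xs = br a' b'" using foldl_br_bracket by blast
  have "br (br a b) (foldl br (br c d) (x # xs)) = br (br (br c d) x) (foldl br (br a b) xs)"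
    using Cons.IH[of "br c d" x] by simp
  also have "\<dots> = br (br c d) (foldl br (br a b) (xs @ [x]))"
    by (simp add: f shift)
  also have "\<dots> = br (br c d) (foldl br (br a b) (x # xs))"
    by (rule bracket_foldl_perm) simp
  finally show ?case .
qed

lemma bracket_foldl_jacobi:
  "br (br a b) (foldl br (br c d) (x # xs))
   = br (br a b) (foldl br (br c x) (d # xs)) + br (br a b) (foldl br (br d x) (c # xs))"
  by (simp add: jacobi_cyclic[of c d x] foldl_br_add br_add_right)

text \<open>By \<open>foldl_swap\<close> each adjacent swap costs a term that is zero when letters
  follow and otherwise lies in \<open>S\<close> by \<open>d2\<close>. The prefix \<open>us\<close>
  lets the induction pass over letters already in place.\<close>

lemma foldl_perm_mod:
  assumes S: "subspace S"
    and d2: "\<And>us s t. br (foldl br (br a b) (map y us)) (br (y s) (y t)) \<in> S"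
  shows "mset xs = mset ys \<Longrightarrow>
    foldl br (br a b) (map y (us @ xs)) + foldl br (br a b) (map y (us @ ys)) \<in> S"
proof (induction xs arbitrary: us ys)
  case Nil
  then show ?case using S by (simp add: add_self subspace_0)
next
  case (Cons x xs)
  let ?f = "\<lambda>us. foldl br (br a b) (map y us)"
  have tr: "p + r \<in> S" if "p + q \<in> S" "q + r \<in> S" for p q r
  proof -
    have "p + q + (q + r) \<in> S" using S that by (rule subspace_add)
    moreover have "p + q + (q + r) = p + (q + q) + r" by (simp add: add_ac)
    ultimately show ?thesis by (simp add: add_self)
  qed
  have move: "?f (us @ x # vs @ ws) + ?f (us @ vs @ x # ws) \<in> S" for us vs ws
  proof (induction vs arbitrary: us)
    case Nil
    then show ?case using S by (simp add: add_self subspace_0)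
  next
    case (Cons v vs)
    obtain a' b' where ab: "?f us = br a' b'" using foldl_br_bracket by blast
    have "?f (us @ x # v # vs @ ws) + ?f (us @ v # x # vs @ ws)
      = foldl br (br (?f us) (br (y x) (y v))) (map y (vs @ ws))"
      using foldl_swap[of a' b' "y x" "y v" "map y (vs @ ws)"] by (simp add: ab)
    moreover have "\<dots> \<in> S"
    proof (cases "vs @ ws = []")
      case False
      then show ?thesis using S unfolding ab
        by (subst foldl_br_derived2) (simp_all add: subspace_0)
    qed (use d2 in simp)
    ultimately have "?f (us @ x # v # vs @ ws) + ?f (us @ v # x # vs @ ws) \<in> S" by simp
    with Cons.IH[of "us @ [v]"] show ?case by (auto intro: tr)
  qed
  from Cons.prems have "x \<in> set ys" by (metis list.set_intros(1) mset_eq_setD)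
  then obtain vs ws where ys: "ys = vs @ x # ws" by (auto dest: split_list)
  with Cons.prems have "mset xs = mset (vs @ ws)" by simp
  from Cons.IH[OF this, of "us @ [x]"] show ?case
    using move[of us vs ws] by (auto simp: ys intro: tr)
qed

end

section \<open>Spanning by normal words\<close>

text \<open>Tails are multisets because their order is immaterial in double products and matters in
  single ones only modulo double products; \<open>word_val\<close> fixes the sorted order.\<close>

datatype lie_word =
    Gen nat
  | Single nat nat "nat multiset"
  | Double nat nat nat nat "nat multiset"

primrec word_val :: "('b \<Rightarrow> 'b \<Rightarrow> 'b) \<Rightarrow> (nat \<Rightarrow> 'b) \<Rightarrow> lie_word \<Rightarrow> 'b" where
  "word_val br y (Gen i) = y i"
| "word_val br y (Single i j T) =
    foldl br (br (y i) (y j)) (map y (sorted_list_of_multiset T))"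
| "word_val br y (Double i j k l T) =
    br (br (y i) (y j)) (foldl br (br (y k) (y l)) (map y (sorted_list_of_multiset T)))"

primrec word_deg :: "lie_word \<Rightarrow> nat multiset" where
  "word_deg (Gen i) = {#i#}"
| "word_deg (Single i j T) = {#i, j#} + T"
| "word_deg (Double i j k l T) = {#i, j, k, l#} + T"

text \<open>
  In a multidegree \<open>d\<close> where some letter \<open>v\<close> repeats, the products \<open>(x\<^sub>i v)(x\<^sub>k v\<dots>)\<close> with \<open>i < k\<close>
  suffice. If \<open>d\<close> is multiplicity free with least letters \<open>p < q < r\<close>, the products
  \<open>(p x\<^sub>j)(q x\<^sub>l\<dots>)\<close> with \<open>j < l\<close> and \<open>(p q)(r x\<^sub>l\<dots>)\<close> do.
\<close>

definition heavy :: "nat multiset \<Rightarrow> nat" where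
  "heavy d = (SOME v. 2 \<le> count d v)"

definition min1 :: "nat multiset \<Rightarrow> nat" where
  "min1 d = Min (set_mset d)"

definition min2 :: "nat multiset \<Rightarrow> nat" where
  "min2 d = Min (set_mset d - {min1 d})"

definition min3 :: "nat multiset \<Rightarrow> nat" where
  "min3 d = Min (set_mset d - {min1 d, min2 d})"

fun normal :: "lie_word \<Rightarrow> bool" where
  "normal (Gen i) \<longleftrightarrow> True"
| "normal (Single i j T) \<longleftrightarrow> i \<noteq> j \<and> j = min1 ({#i, j#} + T)"
| "normal (Double i j k l T) \<longleftrightarrow>
    (let d = {#i, j, k, l#} + T in
      if \<exists>v. 2 \<le> count d v
      then j = heavy d \<and> l = heavy d \<and> i < k \<and> i \<noteq> heavy d \<and> k \<noteq> heavy d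
      else i = min1 d \<and> (k = min2 d \<and> j < l \<or> j = min2 d \<and> k = min3 d))"

lemma min1_in: "d \<noteq> {#} \<Longrightarrow> min1 d \<in># d"
  unfolding min1_def by (intro Min_in) auto

lemma heavy_count: "2 \<le> count d v \<Longrightarrow> 2 \<le> count d (heavy d)"
  unfolding heavy_def by (rule someI)

lemma min23_in:
  assumes "distinct [i, j, k, l]" and "{i, j, k, l} \<subseteq> set_mset d"
  shows "min2 d \<in> set_mset d - {min1 d}" and "min3 d \<in> set_mset d - {min1 d, min2 d}"
proof -
  have *: "set_mset d - X \<noteq> {}" if "finite X" "card X \<le> 2" for X
  proof
    assume "set_mset d - X = {}"
    then have "{i, j, k, l} \<subseteq> X" using assms by blast
    then have "card {i, j, k, l} \<le> card X" using that by (intro card_mono)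
    then show False using assms that by simp
  qed
  show "min2 d \<in> set_mset d - {min1 d}"
    unfolding min2_def using *[of "{min1 d}"] by (intro Min_in) auto
  show "min3 d \<in> set_mset d - {min1 d, min2 d}"
    unfolding min3_def using *[of "{min1 d, min2 d}"]
    by (intro Min_in) (auto simp: card_insert_if)
qed

context gl2_like
begin

definition normal_span :: "(nat \<Rightarrow> 'b) \<Rightarrow> 'b set" where
  "normal_span y = span (word_val br y ` Collect normal)"

lemma normal_span_base: "normal w \<Longrightarrow> word_val br y w \<in> normal_span y"
  unfolding normal_span_def by (rule span_base) auto

lemma subspace_normal_span: "subspace (normal_span y)"
  unfolding normal_span_def by (rule subspace_span)

lemmas normal_span_add = subspace_add[OF subspace_normal_span]
  and normal_span_zero [simp] = subspace_0[OF subspace_normal_span]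

lemma normal_span_add_cancel:
  assumes "a + b \<in> normal_span y" shows "a \<in> normal_span y \<longleftrightarrow> b \<in> normal_span y"
proof -
  have "a = (a + b) + b" "b = a + (a + b)"
    by (simp add: add.assoc add_self, simp add: add_self flip: add.assoc)
  then show ?thesis using assms normal_span_add by metis
qed

context
  fixes y :: "nat \<Rightarrow> 'b"
begin

section \<open>Reduction of double products to normal words\<close>

abbreviation dbl :: "nat \<Rightarrow> nat \<Rightarrow> nat \<Rightarrow> nat \<Rightarrow> nat multiset \<Rightarrow> 'b" where
  "dbl i j k l T \<equiv> word_val br y (Double i j k l T)"

lemma dbl_mset:
  "br (br (y i) (y j)) (foldl br (br (y k) (y l)) (map y xs)) = dbl i j k l (mset xs)"
  unfolding word_val.simps by (rule bracket_foldl_perm) simp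

lemma dbl_commute: "dbl i j k l T = dbl j i k l T" "dbl i j k l T = dbl i j l k T"
  "dbl i j k l T = dbl k l i j T"
  unfolding word_val.simps
  by (simp add: br_commute, simp add: br_commute, rule bracket_foldl_commute)

lemma dbl_zero: "dbl i i k l T = 0" "dbl i j k k T = 0" "dbl i j i j T = 0" "dbl i j j i T = 0"
  using alternating[of "y i" "y j"] by (simp_all add: br_self br_commute[of "y j"])

text \<open>The Jacobi identity for \<open>k\<close>, \<open>l\<close> and a tail letter
  \<open>s\<close>; it serves to fetch a chosen tail letter into the second bracket.\<close>

lemma dbl_jacobi: "dbl i j k l (add_mset s T) = dbl i j k s (add_mset l T) + dbl i j l s (add_mset k T)"
proof -
  let ?xs = "sorted_list_of_multiset T"
  have "dbl i j k l (add_mset s T) = br (br (y i) (y j)) (foldl br (br (y k) (y l)) (map y (s # ?xs)))"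
    by (subst dbl_mset) simp
  also have "\<dots> = br (br (y i) (y j)) (foldl br (br (y k) (y s)) (map y (l # ?xs)))
      + br (br (y i) (y j)) (foldl br (br (y l) (y s)) (map y (k # ?xs)))"
    unfolding list.map by (rule bracket_foldl_jacobi)
  finally show ?thesis by (simp only: dbl_mset) simp
qed

lemma dbl_exchange: "dbl i j k l T = dbl i k j l T + dbl i l j k T"
  using exchange[of "y i" "y j" "y k" "y l" "map y (sorted_list_of_multiset T)"]
  by (simp add: add.assoc add_eq_0_iff_eq)

text \<open>The repeated letter is brought first into one bracket, then into both; the symmetries of
  \<open>dbl\<close> and \<open>dbl_zero\<close> then leave only words with
  \<open>i < k\<close>.\<close>

lemma dbl_normal_heavy:
  assumes d: "{#i, j, k, l#} + T = d" and v: "2 \<le> count d v"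
  shows "dbl i j k l T \<in> normal_span y"
proof -
  \<comment> \<open>The repeated letter of the assumption is replaced by the canonical one that
    \<open>normal\<close> refers to.\<close>
  define v where "v = heavy d"
  have cv: "2 \<le> count d v" unfolding v_def using assms(2) by (rule heavy_count)
  have lt: "dbl i v k v T \<in> normal_span y"
    if "{#i, v, k, v#} + T = d" "i < k" "i \<noteq> v" "k \<noteq> v" for i k T
    by (rule normal_span_base) (use that cv in \<open>auto simp: v_def Let_def\<close>)
  have step1: "dbl i v k v T \<in> normal_span y" if "{#i, v, k, v#} + T = d" for i k T
  proof -
    consider "i = v" | "k = v" | "i = k" | "i < k" "i \<noteq> v" "k \<noteq> v" | "k < i" "i \<noteq> v" "k \<noteq> v"
      by linarith
    then show ?thesis
    proof cases
      case 5
      with that lt[of k i T] show ?thesis by (subst dbl_commute(3)) (simp add: add_mset_commute)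
    qed (use that lt in \<open>auto simp only: dbl_zero normal_span_zero\<close>)
  qed
  have step2: "dbl i v k l T \<in> normal_span y" if e: "{#i, v, k, l#} + T = d" for i k l T
  proof -
    consider "i = v" | "k = v" | "l = v" | "i \<noteq> v" "k \<noteq> v" "l \<noteq> v" by blast
    then show ?thesis
    proof cases
      case 1 then show ?thesis by (simp only: dbl_zero normal_span_zero)
    next
      case 2
      then show ?thesis using step1[of i l T] e by (subst dbl_commute(2)) (simp add: add_mset_commute)
    next
      case 3
      then show ?thesis using step1[of i k T] e by simp
    next
      case 4
      \<comment> \<open>The brackets contain \<open>v\<close> once and \<open>d\<close> contains it
        at least twice, so a further copy sits in the tail.\<close>
      with cv e have "v \<in># T" by (intro ccontr[of "v \<in># T"]) (auto simp: not_in_iff)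
      then obtain T' where T: "T = add_mset v T'" by (blast dest: multi_member_split)
      show ?thesis unfolding T
        by (subst dbl_jacobi, intro normal_span_add step1) (simp_all add: T add_mset_commute flip: e)
    qed
  qed
  consider "i = v" | "j = v" | "k = v" | "l = v" | "i \<noteq> v" "j \<noteq> v" "k \<noteq> v" "l \<noteq> v" by blast
  then show ?thesis
  proof cases
    case 1
    then show ?thesis using step2[of j k l T] d by (subst dbl_commute(1)) (simp add: add_mset_commute)
  next
    case 2
    then show ?thesis using step2[of i k l T] d by simp
  next
    case 3
    then show ?thesis using step2[of l i j T] d
      by (subst dbl_commute(3), subst dbl_commute(1)) (simp add: add_mset_commute)
  next
    case 4
    then show ?thesis using step2[of k i j T] d by (subst dbl_commute(3)) (simp add: add_mset_commute)
  next
    case 5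
    with cv d have "v \<in># T" by (intro ccontr[of "v \<in># T"]) (auto simp: not_in_iff)
    then obtain T' where T: "T = add_mset v T'" by (blast dest: multi_member_split)
    have "dbl i j k v (add_mset l T') \<in> normal_span y" "dbl i j l v (add_mset k T') \<in> normal_span y"
      by (subst dbl_commute(3), rule step2, simp add: T add_mset_commute flip: d)+
    then show ?thesis unfolding T by (subst dbl_jacobi) (rule normal_span_add)
  qed
qed

text \<open>All letters are distinct. \<open>min1 d\<close> is moved into the first bracket and then
  \<open>min2 d\<close> into the second; if \<open>min2 d\<close> already stands beside
  \<open>min1 d\<close>, then \<open>min3 d\<close> is moved into the second bracket
  instead.\<close>

lemma dbl_normal_light:
  assumes d: "{#i, j, k, l#} + T = d" and light: "\<And>v. \<not> 2 \<le> count d v"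
  shows "dbl i j k l T \<in> normal_span y"
proof -
  define m1 m2 m3 where m_def: "m1 = min1 d" "m2 = min2 d" "m3 = min3 d"
  have dist: "distinct [i, j, k, l] \<and> i \<notin># T \<and> j \<notin># T \<and> k \<notin># T \<and> l \<notin># T"
    if "{#i, j, k, l#} + T = d" for i j k l T
    using light[of i] light[of j] light[of k] light[of l]
    by (auto simp: that[symmetric] not_in_iff split: if_splits)
  have m: "m1 \<in># d" "m2 \<in># d" "m3 \<in># d" "m2 \<noteq> m1" "m3 \<noteq> m1" "m3 \<noteq> m2"
    using min1_in[of d] min23_in[of i j k l d] dist[OF d] unfolding m_def d[symmetric] by auto
  have base: "normal (Double i j k l T)"
    if "{#i, j, k, l#} + T = d" "i = m1" "k = m2 \<and> j < l \<or> j = m2 \<and> k = m3" for i j k l T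
    using that light unfolding m_def normal.simps Let_def by auto
  have rest: "\<exists>T'. T = add_mset v T'"
    if "{#i, j, k, l#} + T = d" "v \<in># d" "v \<noteq> i" "v \<noteq> j" "v \<noteq> k" "v \<noteq> l" for v i j k l T
  proof -
    have "v \<in># T" using that by (auto simp: that(1)[symmetric])
    then show ?thesis by (rule multi_member_split)
  qed
  have step0: "dbl m1 m2 k l T \<in> normal_span y" if e: "{#m1, m2, k, l#} + T = d" for k l T
  proof -
    have at3: "dbl m1 m2 m3 l T \<in> normal_span y" if "{#m1, m2, m3, l#} + T = d" for l T
      by (rule normal_span_base, rule base) (use that in auto)
    consider "k = m3" | "l = m3" | "k \<noteq> m3" "l \<noteq> m3" by blast
    then show ?thesis
    proof cases
      case 1
      with at3[of l T] e show ?thesis by simp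
    next
      case 2
      with at3[of k T] e show ?thesis by (subst dbl_commute(2)) (simp add: add_mset_commute)
    next
      case 3
      then obtain T' where T: "T = add_mset m3 T'" using rest[OF e, of m3] m by blast
      have "dbl m1 m2 k m3 (add_mset l T') \<in> normal_span y"
        "dbl m1 m2 l m3 (add_mset k T') \<in> normal_span y"
        by (subst dbl_commute(2), rule at3, simp add: T add_mset_commute flip: e)+
      then show ?thesis unfolding T by (subst dbl_jacobi) (rule normal_span_add)
    qed
  qed
  have step1: "dbl m1 i m2 k T \<in> normal_span y" if e: "{#m1, i, m2, k#} + T = d" for i k T
  proof -
    have ik: "i \<noteq> k" using dist[OF e] by simp
    have lt: "dbl m1 i m2 k T \<in> normal_span y" if "{#m1, i, m2, k#} + T = d" "i < k" for i k T
      by (rule normal_span_base, rule base) (use that in auto)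
    show ?thesis
    proof (cases "i < k")
      case False
      \<comment> \<open>The exchange relation swaps \<open>i\<close> and \<open>k\<close> at the
        price of a word with \<open>m1\<close> and \<open>m2\<close> in one bracket, which
        \<open>step0\<close> covers.\<close>
      have "dbl m1 i m2 k T = dbl m1 m2 i k T + dbl m1 k m2 i T"
        by (subst dbl_exchange) (simp only: dbl_commute(2)[of m1 k i])
      moreover have "dbl m1 m2 i k T \<in> normal_span y"
        by (rule step0) (simp add: add_mset_commute flip: e)
      moreover have "dbl m1 k m2 i T \<in> normal_span y"
        by (rule lt) (use ik False in \<open>simp_all add: add_mset_commute flip: e\<close>)
      ultimately show ?thesis using normal_span_add by metis
    qed (use lt e in simp)
  qed
  have step2: "dbl m1 i k l T \<in> normal_span y" if e: "{#m1, i, k, l#} + T = d" for i k l T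
  proof -
    consider "i = m2" | "k = m2" | "l = m2" | "i \<noteq> m2" "k \<noteq> m2" "l \<noteq> m2" by blast
    then show ?thesis
    proof cases
      case 1
      with step0[of k l T] e show ?thesis by simp
    next
      case 2
      with step1[of i l T] e show ?thesis by simp
    next
      case 3
      with step1[of i k T] e show ?thesis by (subst dbl_commute(2)) (simp add: add_mset_commute)
    next
      case 4
      then obtain T' where T: "T = add_mset m2 T'" using rest[OF e, of m2] m by blast
      have "dbl m1 i k m2 (add_mset l T') \<in> normal_span y"
        "dbl m1 i l m2 (add_mset k T') \<in> normal_span y"
        by (subst dbl_commute(2), rule step1, simp add: T add_mset_commute flip: e)+
      then show ?thesis unfolding T by (subst dbl_jacobi) (rule normal_span_add)
    qed
  qed
  consider "i = m1" | "j = m1" | "k = m1" | "l = m1" | "i \<noteq> m1" "j \<noteq> m1" "k \<noteq> m1" "l \<noteq> m1" by blast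
  then show ?thesis
  proof cases
    case 1
    then show ?thesis using step2[of j k l T] d by simp
  next
    case 2
    then show ?thesis using step2[of i k l T] d by (subst dbl_commute(1)) (simp add: add_mset_commute)
  next
    case 3
    then show ?thesis using step2[of l i j T] d
      by (subst dbl_commute(3)) (simp add: add_mset_commute)
  next
    case 4
    then show ?thesis using step2[of k i j T] d
      by (subst dbl_commute(3), subst dbl_commute(1)) (simp add: add_mset_commute)
  next
    case 5
    then obtain T' where T: "T = add_mset m1 T'" using rest[OF d, of m1] m by blast
    have "dbl i j k m1 (add_mset l T') \<in> normal_span y" "dbl i j l m1 (add_mset k T') \<in> normal_span y"
      by (subst dbl_commute(3), subst dbl_commute(1), rule step2, simp add: T add_mset_commute flip: d)+
    then show ?thesis unfolding T by (subst dbl_jacobi) (rule normal_span_add)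
  qed
qed

lemma dbl_normal: "dbl i j k l T \<in> normal_span y"
  using dbl_normal_heavy[OF HOL.refl] dbl_normal_light[OF HOL.refl] by blast

section \<open>Single products modulo double products\<close>

lemma foldl_perm_normal:
  assumes "mset xs = mset ys"
  shows "foldl br (br (y i) (y j)) (map y xs) \<in> normal_span y
     \<longleftrightarrow> foldl br (br (y i) (y j)) (map y ys) \<in> normal_span y"
proof (rule normal_span_add_cancel)
  have "br (foldl br (br (y i) (y j)) (map y us)) (br (y s) (y t)) \<in> normal_span y" for us s t
    using dbl_normal[of s t i j "mset us"] by (simp only: flip: dbl_mset) (simp add: br_commute)
  from foldl_perm_mod[OF subspace_normal_span this assms, of "[]"]
  show "foldl br (br (y i) (y j)) (map y xs) + foldl br (br (y i) (y j)) (map y ys) \<in> normal_span y"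
    by simp
qed

text \<open>The least letter is taken to the front of the tail, at the cost of double products only,
  and the Jacobi identity then brings it into the leading bracket.\<close>

lemma single_normal: "foldl br (br (y i) (y j)) (map y xs) \<in> normal_span y"
proof -
  define d where "d = {#i, j#} + mset xs"
  define m where "m = min1 d"
  have "m \<in># d" unfolding m_def by (rule min1_in) (simp add: d_def)
  have base: "foldl br (br (y i) (y m)) (map y xs) \<in> normal_span y" if "{#i, m#} + mset xs = d" for i xs
  proof (cases "i = m")
    case False
    then have "word_val br y (Single i m (mset xs)) \<in> normal_span y"
      by (intro normal_span_base) (use that in \<open>simp add: m_def\<close>)
    then show ?thesis using foldl_perm_normal[of xs "sorted_list_of_multiset (mset xs)"] by simp
  qed (simp add: br_self)
  consider "i = m" | "j = m" | "m \<in># mset xs" using \<open>m \<in># d\<close> unfolding d_def by auto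
  then show ?thesis
  proof cases
    case 1
    then show ?thesis using base[of j xs] by (simp add: d_def br_commute add_mset_commute)
  next
    case 2
    then show ?thesis using base[of i xs] by (simp add: d_def)
  next
    case 3
    then obtain us vs where xs: "xs = us @ m # vs" by (auto dest: split_list)
    have "foldl br (br (y i) (y j)) (map y (m # us @ vs))
      = foldl br (br (y i) (y m)) (map y (j # us @ vs)) + foldl br (br (y j) (y m)) (map y (i # us @ vs))"
      by (simp add: jacobi_cyclic[of "y i" "y j"] foldl_br_add)
    moreover have "\<dots> \<in> normal_span y"
      by (intro normal_span_add base) (simp_all add: d_def xs add_mset_commute)
    ultimately have "foldl br (br (y i) (y j)) (map y (m # us @ vs)) \<in> normal_span y" by metis
    then show ?thesis
      by (subst foldl_perm_normal[of _ "m # us @ vs"]) (simp_all only: xs, simp)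
  qed
qed

section \<open>Spanning by left-normalized products\<close>

definition left_span :: "'b set" where
  "left_span = span {foldl br (y i) (map y xs) | i xs. True}"

lemma left_span_subset: "left_span \<subseteq> normal_span y"
  unfolding left_span_def
proof (rule span_minimal[OF _ subspace_normal_span], safe)
  fix i xs
  show "foldl br (y i) (map y xs) \<in> normal_span y"
  proof (cases xs)
    case Nil
    then show ?thesis using normal_span_base[of "Gen i" y] by simp
  next
    case (Cons x xs)
    then show ?thesis using single_normal[of i x xs] by simp
  qed
qed

lemma left_span_br_gen:
  assumes "p \<in> left_span" shows "br p (y k) \<in> left_span"
  using assms unfolding left_span_def
proof (induction rule: span_induct_alt)
  case base
  show ?case by (simp add: span_zero)
next
  case (step c p q)
  then obtain i xs where p: "p = foldl br (y i) (map y xs)" by blast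
  have "br p (y k) = foldl br (y i) (map y (xs @ [k]))" by (simp add: p)
  then have "br p (y k) \<in> span {foldl br (y i) (map y xs) | i xs. True}" by (blast intro: span_base)
  with step show ?case by (simp add: br_add_left br_scale_left span_add span_scale)
qed

text \<open>Induction on the second factor by \<open>p(wx) = (pw)x + (px)w\<close>; \<open>p\<close>
  is arbitrary because the hypothesis is applied to \<open>px\<close> as well.\<close>

lemma left_span_br_word:
  "p \<in> left_span \<Longrightarrow> br p (foldl br (y i) (map y xs)) \<in> left_span"
proof (induction xs arbitrary: p rule: rev_induct)
  case Nil
  then show ?case by (simp add: left_span_br_gen)
next
  case (snoc x xs)
  let ?w = "foldl br (y i) (map y xs)"
  have "br p (br ?w (y x)) = br (br p ?w) (y x) + br (br p (y x)) ?w"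
    by (metis jacobi_cyclic br_commute add.commute)
  moreover have "br (br p ?w) (y x) \<in> left_span" "br (br p (y x)) ?w \<in> left_span"
    using snoc by (blast intro: left_span_br_gen)+
  ultimately have "br p (br ?w (y x)) \<in> left_span"
    unfolding left_span_def by (simp add: span_add)
  then show ?case by simp
qed

lemma left_span_br:
  assumes p: "p \<in> left_span" and q: "q \<in> left_span" shows "br p q \<in> left_span"
  using q unfolding left_span_def
proof (induction rule: span_induct_alt)
  case base
  show ?case by (simp add: span_zero)
next
  case (step c q r)
  then have "br p q \<in> left_span" using left_span_br_word[OF p] by blast
  with step show ?case by (simp add: br_add_right br_scale_right span_add span_scale left_span_def)
qed

end

lemma term_eval_normal: "term_eval v t \<in> normal_span (\<lambda>i. v (Suc i))"
proof -
  let ?y = "\<lambda>i. v (Suc i)"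
  have "term_eval v t \<in> left_span ?y"
  proof (induction t)
    case (TGen i)
    have "?y i = foldl br (?y i) (map ?y [])" by simp
    then show ?case unfolding left_span_def term_eval.simps
      by (intro span_base) (metis (mono_tags, lifting) list.map(1) mem_Collect_eq)
  next
    case (TBr s t)
    then show ?case by (simp add: left_span_br)
  qed (auto simp: left_span_def span_zero span_add span_scale)
  then show ?thesis using left_span_subset by blast
qed

end

section \<open>Independence of normal words in \<open>gl\<^sub>2\<close>\<close>

abbreviation monomial :: "(nat \<Rightarrow> 'f) \<Rightarrow> nat multiset \<Rightarrow> 'f::comm_monoid_mult" where
  "monomial a d \<equiv> (\<Prod>i\<in>#d. a i)"

lemma monomial_at: "monomial (\<lambda>j. if j = i then t else 1) d = (t :: 'f::comm_semiring_1) ^ count d i"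
  by (induction d) auto

lemma monomial_mult:
  "monomial (\<lambda>i. a i * s i) d = monomial a d * (monomial s d :: 'f::comm_semiring_1)"
  by (induction d) (auto simp: mult_ac)

lemma infinite_field_power_neq:
  assumes "infinite (UNIV :: 'f::field set)" and "m \<noteq> n"
  shows "\<exists>t :: 'f. t ^ m \<noteq> t ^ n"
proof (rule ccontr)
  assume "\<not> ?thesis"
  then have "{x. poly (monom 1 m - monom 1 n) x = 0} = (UNIV :: 'f set)" by (auto simp: poly_monom)
  moreover have "monom 1 m - monom 1 n \<noteq> (0 :: 'f poly)"
    using assms(2) by (metis coeff_monom eq_iff_diff_eq_0 zero_neq_one)
  ultimately show False using poly_roots_finite assms(1) by metis
qed

text \<open>Artin's independence of characters: distinct monomials are distinct characters of the
  multiplicative monoid of all points.\<close>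

lemma monomials_independent:
  fixes c :: "nat multiset \<Rightarrow> 'f::field"
  assumes inf: "infinite (UNIV :: 'f set)" and "finite M"
  shows "(\<And>a. (\<Sum>d\<in>M. c d * monomial a d) = 0) \<Longrightarrow> \<forall>d\<in>M. c d = 0"
  using \<open>finite M\<close>
proof (induction M arbitrary: c rule: finite_induct)
  case (insert d0 M)
  have M: "c e = 0" if e: "e \<in> M" for e
  proof -
    from e insert.hyps have "e \<noteq> d0" by blast
    then obtain i where "count e i \<noteq> count d0 i" by (auto simp: multiset_eq_iff)
    then obtain t :: 'f where t: "t ^ count e i \<noteq> t ^ count d0 i"
      using infinite_field_power_neq[OF inf] by blast
    \<comment> \<open>Rescaling coordinate \<open>i\<close> alone distinguishes \<open>e\<close>
      from \<open>d0\<close>. Subtracting \<open>monomial s d0\<close> times the relation from the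
      relation at the rescaled point eliminates \<open>d0\<close>.\<close>
    define s where "s = (\<lambda>j. if j = i then t else 1)"
    have "(\<Sum>d\<in>M. (c d * (monomial s d - monomial s d0)) * monomial a d) = 0" for a
    proof -
      have "0 = (\<Sum>d\<in>insert d0 M. c d * monomial (\<lambda>i. a i * s i) d)
          - monomial s d0 * (\<Sum>d\<in>insert d0 M. c d * monomial a d)"
        by (simp only: insert.prems) simp
      also have "\<dots> = (\<Sum>d\<in>insert d0 M. (c d * (monomial s d - monomial s d0)) * monomial a d)"
        by (simp only: monomial_mult sum_distrib_left flip: sum_subtractf)
           (simp add: algebra_simps)
      finally show ?thesis using insert.hyps by simp
    qed
    from insert.IH[OF this] e have "c e * (monomial s e - monomial s d0) = 0" by blast
    with t show ?thesis by (simp add: s_def monomial_at)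
  qed
  have "c d0 = 0" using insert.prems[of "\<lambda>_. 1"] insert.hyps M by simp
  with M show ?case by simp
qed simp

text \<open>Several \<open>w\<close> may share a monomial, so independence gives the vanishing of
  the sum over each fibre of \<open>m\<close>.\<close>

lemma monomial_coeffs_zero:
  fixes k :: "'a \<Rightarrow> 'f::field"
  assumes "infinite (UNIV :: 'f set)" and "finite W"
    and zero: "\<And>a. (\<Sum>w\<in>W. k w * monomial a (m w)) = 0"
  shows "(\<Sum>w | w \<in> W \<and> m w = d. k w) = 0"
proof (cases "d \<in> m ` W")
  case True
  have "(\<Sum>d\<in>m ` W. (\<Sum>w | w \<in> W \<and> m w = d. k w) * monomial a d) = 0" for a
  proof -
    have "(\<Sum>d\<in>m ` W. (\<Sum>w | w \<in> W \<and> m w = d. k w) * monomial a d)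
        = (\<Sum>d\<in>m ` W. \<Sum>w | w \<in> W \<and> m w = d. k w * monomial a (m w))"
      by (simp add: sum_distrib_right)
    also have "\<dots> = (\<Sum>w\<in>W. k w * monomial a (m w))"
      using \<open>finite W\<close> by (rule sum.image_gen[symmetric])
    finally show ?thesis by (simp add: zero)
  qed
  from monomials_independent[OF assms(1) _ this] True \<open>finite W\<close> show ?thesis by blast
next
  case False
  then have "{w. w \<in> W \<and> m w = d} = {}" by auto
  then show ?thesis by (simp only: sum.empty)
qed

section \<open>Entries of commutators in characteristic two\<close>

definition gmat :: "'f \<Rightarrow> 'f \<Rightarrow> 'f \<Rightarrow> 'f::field^2^2" where
  "gmat a b c = vector [vector [a, b], vector [c, 0]]"

lemma gmat_nth [simp]:
  "gmat a b c $ 1 $ 1 = a" "gmat a b c $ 1 $ 2 = b" "gmat a b c $ 2 $ 1 = c" "gmat a b c $ 2 $ 2 = 0"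
  by (simp_all add: gmat_def)

lemma commutator_nth:
  "commutator A B $ 1 $ 1 = A $ 1 $ 2 * B $ 2 $ 1 - B $ 1 $ 2 * A $ 2 $ 1"
  "commutator A B $ 1 $ 2 = A $ 1 $ 1 * B $ 1 $ 2 + A $ 1 $ 2 * B $ 2 $ 2 - B $ 1 $ 1 * A $ 1 $ 2 - B $ 1 $ 2 * A $ 2 $ 2"
  "commutator A B $ 2 $ 1 = A $ 2 $ 1 * B $ 1 $ 1 + A $ 2 $ 2 * B $ 2 $ 1 - B $ 2 $ 1 * A $ 1 $ 1 - B $ 2 $ 2 * A $ 2 $ 1"
  "commutator A B $ 2 $ 2 = A $ 2 $ 1 * B $ 1 $ 2 - B $ 2 $ 1 * A $ 1 $ 2"
  by (simp_all add: commutator_def matrix_matrix_mult_def sum_2 algebra_simps)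

lemma char2_two: "CHAR('f::field) = 2 \<Longrightarrow> (2 :: 'f) = 0"
  using of_nat_CHAR[where 'a = 'f] by simp

lemma char2_uminus:
  assumes "CHAR('f::field) = 2" shows "- x = (x::'f)"
  using char2_two[OF assms] by (metis add.inverse_unique mult_2 mult_zero_left)

lemma char2_minus:
  assumes "CHAR('f::field) = 2" shows "x - y = x + (y::'f)"
  using char2_uminus[OF assms, of y] by (metis diff_conv_add_uminus)

context
  assumes char2: "CHAR('f::field) = 2"
begin

lemmas char2_simps = char2_minus[OF char2] char2_two[OF char2]

text \<open>A commutator has trace zero, which in characteristic two makes its diagonal entries
  equal.\<close>

lemma commutator_diag: "commutator A B $ 2 $ 2 = (commutator A B $ 1 $ 1 :: 'f)"
  by (simp add: commutator_nth char2_simps algebra_simps)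

text \<open>When \<open>M\<close> has equal diagonal entries, bracketing with \<open>x\<close>
  scales both off-diagonal entries by the same factor: the sign that would distinguish them
  disappears in characteristic two.\<close>

lemma foldl_commutator_nth:
  fixes M :: "'f^2^2"
  assumes "M $ 2 $ 2 = M $ 1 $ 1"
  shows "foldl commutator M xs $ 2 $ 2 = foldl commutator M xs $ 1 $ 1"
    "foldl commutator M xs $ 1 $ 2 = M $ 1 $ 2 * (\<Prod>x\<leftarrow>xs. x $ 1 $ 1 - x $ 2 $ 2)"
    "foldl commutator M xs $ 2 $ 1 = M $ 2 $ 1 * (\<Prod>x\<leftarrow>xs. x $ 1 $ 1 - x $ 2 $ 2)"
  using assms
  by (induction xs arbitrary: M)
     (simp_all add: commutator_diag, simp_all add: commutator_nth char2_simps algebra_simps)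

text \<open>Two matrices with equal diagonal entries have a scalar commutator, given by the
  determinant of their off-diagonal entries; the tail only contributes a factor.\<close>

lemma double_commutator_nth:
  fixes A B C D :: "'f^2^2" and xs :: "('f^2^2) list"
  defines "P \<equiv> commutator A B" and "Q \<equiv> foldl commutator (commutator C D) xs"
  shows "commutator P Q $ 1 $ 2 = 0" "commutator P Q $ 2 $ 1 = 0"
    "commutator P Q $ 1 $ 1 = (P $ 1 $ 2 * commutator C D $ 2 $ 1 + commutator C D $ 1 $ 2 * P $ 2 $ 1)
       * (\<Prod>x\<leftarrow>xs. x $ 1 $ 1 - x $ 2 $ 2)"
proof -
  have "P $ 2 $ 2 = P $ 1 $ 1" unfolding P_def by (rule commutator_diag)
  moreover note Q = foldl_commutator_nth[OF commutator_diag[of C D], of xs, folded Q_def]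
  ultimately show "commutator P Q $ 1 $ 2 = 0" "commutator P Q $ 2 $ 1 = 0"
    "commutator P Q $ 1 $ 1 = (P $ 1 $ 2 * commutator C D $ 2 $ 1 + commutator C D $ 1 $ 2 * P $ 2 $ 1)
       * (\<Prod>x\<leftarrow>xs. x $ 1 $ 1 - x $ 2 $ 2)"
    by (simp_all only: commutator_nth(1-3)[of P Q]) (simp_all add: Q algebra_simps char2_simps)
qed

lemma prod_list_gmat:
  "(\<Prod>x\<leftarrow>map (\<lambda>i. gmat (a i) (b i) (c i)) xs. x $ 1 $ 1 - x $ 2 $ 2) = (monomial a (mset xs) :: 'f)"
  by (induction xs) simp_all

section \<open>Values of words at special points\<close>

primrec coeff1 :: "nat \<Rightarrow> lie_word \<Rightarrow> 'f" where
  "coeff1 p (Gen i) = of_bool (i = p)"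
| "coeff1 p (Single i j T) = of_bool (i = p) + of_bool (j = p)"
| "coeff1 p (Double i j k l T) = 0"

lemma word_val_12:
  "word_val commutator (\<lambda>i. gmat (a i) (of_bool (i = p)) (c i)) w $ 1 $ 2
    = coeff1 p w * monomial a (word_deg w - {#p#})"
proof (cases w)
  case (Single i j T)
  show ?thesis
    unfolding Single word_val.simps foldl_commutator_nth(2)[OF commutator_diag] prod_list_gmat
    by (auto simp: commutator_nth char2_minus[OF char2] add_mset_commute)
next
  case (Double i j k l T)
  then show ?thesis by (simp add: double_commutator_nth)
qed simp

text \<open>This is \<open>b i * c j + b j * c i\<close> for the indicators \<open>b\<close> of
  \<open>p\<close> and \<open>c\<close> of \<open>q\<close>, provided that p \<noteq> q.\<close>

definition pair_ind :: "nat \<Rightarrow> nat \<Rightarrow> nat \<Rightarrow> nat \<Rightarrow> 'f" where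
  "pair_ind p q i j = of_bool (i = p \<and> j = q \<or> i = q \<and> j = p)"

primrec coeff2 :: "nat \<Rightarrow> nat \<Rightarrow> lie_word \<Rightarrow> 'f" where
  "coeff2 p q (Gen i) = 0"
| "coeff2 p q (Single i j T) = 0"
| "coeff2 p q (Double i j k l T) =
    pair_ind p q i k + pair_ind p q i l + pair_ind p q j k + pair_ind p q j l"

text \<open>In the determinant, terms taking both off-diagonal units from one bracket do not occur,
  so \<open>p\<close> and \<open>q\<close> must come from different brackets; this gives the four
  summands of \<open>coeff2\<close>.\<close>

lemma word_val_11:
  assumes "p \<noteq> q"
  shows "word_val commutator (\<lambda>i. gmat (a i) (of_bool (i = p)) (of_bool (i = q))) (Double i j k l T) $ 1 $ 1
    = coeff2 p q (Double i j k l T) * monomial a (word_deg (Double i j k l T) - {#p, q#})"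
proof -
  let ?b = "\<lambda>i. of_bool (i = p) :: 'f" and ?c = "\<lambda>i. of_bool (i = q) :: 'f"
  have u: "?b i * ?c j + ?b j * ?c i = pair_ind p q i j" for i j
    using assms by (auto simp: pair_ind_def)
  \<comment> \<open>Where the indicator is nonzero, removing \<open>p\<close> and \<open>q\<close>
    from the degree is removing \<open>r\<close> and \<open>s\<close>.\<close>
  have t: "pair_ind p q r s * monomial a (d - {#p, q#}) = pair_ind p q r s * monomial a e"
    if "d = {#r, s#} + e" for r s d e
    using that by (auto simp: pair_ind_def add_mset_commute)
  have "word_val commutator (\<lambda>i. gmat (a i) (?b i) (?c i)) (Double i j k l T) $ 1 $ 1
    = ((a i * ?b j + a j * ?b i) * (a k * ?c l + a l * ?c k)
       + (a k * ?b l + a l * ?b k) * (a i * ?c j + a j * ?c i)) * monomial a T"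
    unfolding word_val.simps double_commutator_nth(3) prod_list_gmat
    by (simp add: commutator_nth char2_minus[OF char2] mult.commute add.commute)
  also have "\<dots> = (pair_ind p q i k * (a j * a l) + pair_ind p q i l * (a j * a k)
      + pair_ind p q j k * (a i * a l) + pair_ind p q j l * (a i * a k)) * monomial a T"
    unfolding u[symmetric] by (simp only: algebra_simps)
  also have "\<dots> = coeff2 p q (Double i j k l T) * monomial a (word_deg (Double i j k l T) - {#p, q#})"
    unfolding coeff2.simps word_deg.simps distrib_right
    by (subst (1 2 3 4) t) (auto simp: mult_ac add_mset_commute)
  finally show ?thesis .
qed

section \<open>Extraction of the coefficients of normal words\<close>

lemma sum_single_zero:
  assumes "sum g S = 0" "finite S" "x \<in> S" "\<And>w. w \<in> S \<Longrightarrow> w \<noteq> x \<Longrightarrow> g w = 0"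
  shows "g x = (0 :: 'f)"
  using assms by (simp add: sum.remove[of S x g] sum.neutral)

text \<open>For each normal word a choice of \<open>p\<close>, or of \<open>p\<close> and
  \<open>q\<close>, and of a monomial isolates it among the words whose coefficients are not yet
  known to vanish: first generators and single words, then double words.\<close>

lemma normal_words_independent:
  fixes c :: "lie_word \<Rightarrow> 'f"
  assumes inf: "infinite (UNIV :: 'f set)" and fin: "finite W" and W: "\<And>w. w \<in> W \<Longrightarrow> normal w"
    and zero: "\<And>y. (\<Sum>w\<in>W. mscale (c w) (word_val commutator y w)) = 0"
    and w0: "w0 \<in> W"
  shows "c w0 = 0"
proof -
  have eq1: "(\<Sum>w | w \<in> W \<and> word_deg w - {#p#} = d. c w * coeff1 p w) = 0" for p d
  proof (rule monomial_coeffs_zero[OF inf fin])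
    fix a :: "nat \<Rightarrow> 'f"
    have "0 = (\<Sum>w\<in>W. mscale (c w)
        (word_val commutator (\<lambda>i. gmat (a i) (of_bool (i = p)) 0) w)) $ 1 $ 2"
      by (simp only: zero zero_index)
    also have "\<dots> = (\<Sum>w\<in>W. c w * coeff1 p w * monomial a (word_deg w - {#p#}))"
      by (simp add: mscale_def word_val_12 mult.assoc)
    finally show "(\<Sum>w\<in>W. c w * coeff1 p w * monomial a (word_deg w - {#p#})) = 0" by simp
  qed
  have deg1: "word_deg w = d" if "coeff1 p w \<noteq> 0" "word_deg w - {#p#} = d - {#p#}" "p \<in># d" for w p d
  proof -
    have "p \<in># word_deg w" using that(1) by (cases w) auto
    with that show ?thesis by (metis insert_DiffM)
  qed
  have gen: "c (Gen i) = 0" if "Gen i \<in> W" for i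
  proof -
    have "c (Gen i) * coeff1 i (Gen i) = 0"
    proof (rule sum_single_zero[OF eq1[of i "{#i#} - {#i#}"]])
      fix w assume w: "w \<in> {w \<in> W. word_deg w - {#i#} = {#i#} - {#i#}}" "w \<noteq> Gen i"
      show "c w * coeff1 i w = 0"
      proof (rule ccontr)
        assume "\<not> ?thesis"
        then have "word_deg w = {#i#}" using w by (intro deg1[of i]) auto
        with w show False by (cases w) auto
      qed
    qed (use fin that in auto)
    then show ?thesis by simp
  qed
  have single: "c (Single i j T) = 0" if s: "Single i j T \<in> W" for i j T
  proof -
    define d where "d = {#i, j#} + T"
    have ij: "i \<noteq> j" "j = min1 d" using W[OF s] by (simp_all add: d_def)
    \<comment> \<open>The second letter of a normal single word is \<open>min1 d\<close>, so within
      degree \<open>d\<close> the choice \<open>p = i\<close> sees only the word starting with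
      \<open>i\<close>.\<close>
    have "c (Single i j T) * coeff1 i (Single i j T) = 0"
    proof (rule sum_single_zero[OF eq1[of i "d - {#i#}"]])
      fix w assume w: "w \<in> {w \<in> W. word_deg w - {#i#} = d - {#i#}}" "w \<noteq> Single i j T"
      show "c w * coeff1 i w = 0"
      proof (rule ccontr)
        assume nz: "\<not> ?thesis"
        then have deg: "word_deg w = d" using w by (intro deg1[of i]) (auto simp: d_def)
        show False
        proof (cases w)
          case (Gen k)
          with deg show ?thesis by (simp add: d_def)
        next
          case (Single k l U)
          then have "l = j" using W[of w] w(1) deg ij by simp
          with Single nz ij have "k = i" by (auto split: if_splits)
          with \<open>l = j\<close> deg Single w(2) show ?thesis by (simp add: d_def)
        qed (use nz in simp)
      qed
    qed (use fin s in \<open>auto simp: d_def\<close>)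
    with ij show ?thesis by simp
  qed
  have eq2: "(\<Sum>w | w \<in> W \<and> word_deg w - {#p, q#} = d. c w * coeff2 p q w) = 0" if "p \<noteq> q" for p q d
  proof (rule monomial_coeffs_zero[OF inf fin])
    fix a :: "nat \<Rightarrow> 'f"
    let ?y = "\<lambda>i. gmat (a i) (of_bool (i = p)) (of_bool (i = q))"
    \<comment> \<open>Generators and single words may also have a nonzero entry here, but their
      coefficients are already known to vanish.\<close>
    have "c w * word_val commutator ?y w $ 1 $ 1
      = c w * coeff2 p q w * monomial a (word_deg w - {#p, q#})" if "w \<in> W" for w
      using that gen single word_val_11[OF \<open>p \<noteq> q\<close>]
      by (cases w) (simp_all del: word_val.simps word_deg.simps coeff2.simps)
    note vals = this
    have "0 = (\<Sum>w\<in>W. mscale (c w) (word_val commutator ?y w)) $ 1 $ 1"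
      by (simp only: zero zero_index)
    also have "\<dots> = (\<Sum>w\<in>W. c w * word_val commutator ?y w $ 1 $ 1)"
      by (simp add: mscale_def)
    also have "\<dots> = (\<Sum>w\<in>W. c w * coeff2 p q w * monomial a (word_deg w - {#p, q#}))"
      by (intro sum.cong HOL.refl vals)
    finally show "(\<Sum>w\<in>W. c w * coeff2 p q w * monomial a (word_deg w - {#p, q#})) = 0" by simp
  qed
  have deg2: "word_deg w = d" if nz: "coeff2 p q w \<noteq> 0" and sub: "word_deg w - {#p, q#} = d - {#p, q#}"
    "{#p, q#} \<subseteq># d" for w p q d
  proof -
    obtain i j k l T where w: "w = Double i j k l T"
      using nz by (cases w) auto
    have pq: "{#p, q#} \<subseteq># word_deg w" if "pair_ind p q r s \<noteq> 0" "word_deg w = {#r, s#} + e" for r s e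
      using that by (auto simp: pair_ind_def add_mset_commute split: if_splits)
    have "pair_ind p q i k \<noteq> 0 \<or> pair_ind p q i l \<noteq> 0 \<or> pair_ind p q j k \<noteq> 0 \<or> pair_ind p q j l \<noteq> 0"
      using nz unfolding w by auto
    then have "{#p, q#} \<subseteq># word_deg w"
      using pq[of i k "{#j, l#} + T"] pq[of i l "{#j, k#} + T"] pq[of j k "{#i, l#} + T"]
        pq[of j l "{#i, k#} + T"]
      by (auto simp: w add_mset_commute)
    with sub show ?thesis by (metis subset_mset.diff_add)
  qed
  \<comment> \<open>The common frame of the three cases below. Competitors in \<open>uniq\<close>
    may be assumed to have nonzero \<open>c\<close>, so that words eliminated earlier do not
    count.\<close>
  have double: "c (Double i j k l T) = 0"
    if s: "Double i j k l T \<in> W" and d: "d = {#i, j, k, l#} + T" and "p \<noteq> q" "{#p, q#} \<subseteq># d"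
      and one: "coeff2 p q (Double i j k l T) = 1"
      and uniq: "\<And>i' j' k' l' T'. Double i' j' k' l' T' \<in> W \<Longrightarrow> normal (Double i' j' k' l' T') \<Longrightarrow>
        {#i', j', k', l'#} + T' = d \<Longrightarrow> c (Double i' j' k' l' T') \<noteq> 0 \<Longrightarrow>
        coeff2 p q (Double i' j' k' l' T') \<noteq> 0 \<Longrightarrow> i' = i \<and> j' = j \<and> k' = k \<and> l' = l"
    for i j k l T d p q
  proof -
    have "c (Double i j k l T) * coeff2 p q (Double i j k l T) = 0"
    proof (rule sum_single_zero[OF eq2[OF \<open>p \<noteq> q\<close>, of "d - {#p, q#}"]])
      fix w assume w: "w \<in> {w \<in> W. word_deg w - {#p, q#} = d - {#p, q#}}" "w \<noteq> Double i j k l T"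
      show "c w * coeff2 p q w = 0"
      proof (rule ccontr)
        assume nz: "\<not> ?thesis"
        then have deg: "word_deg w = d" using w \<open>{#p, q#} \<subseteq># d\<close> by (intro deg2[of p q]) auto
        show False
        proof (cases w)
          case (Double i' j' k' l' T')
          from uniq[of i' j' k' l' T'] have "i' = i \<and> j' = j \<and> k' = k \<and> l' = l"
            using Double w(1) W[of w] deg nz by auto
          with Double deg d w(2) show ?thesis by simp
        qed (use nz in simp_all)
      qed
    qed (use fin s d in auto)
    with one show ?thesis by simp
  qed
  have heavy: "c (Double i j k l T) = 0"
    if s: "Double i j k l T \<in> W" and d: "d = {#i, j, k, l#} + T" and h: "\<exists>v. 2 \<le> count d v" for i j k l T d
  proof -
    have n: "j = heavy d" "l = heavy d" "i < k" "i \<noteq> heavy d" "k \<noteq> heavy d"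
      using W[OF s] h unfolding normal.simps Let_def d by (simp_all split: if_splits)
    have sub: "{#i, k#} \<subseteq># d" unfolding d by simp
    show ?thesis
    \<comment> \<open>Neither \<open>i\<close> nor \<open>k\<close> is the repeated letter, so this
      pair can only consist of the first letters of the brackets, and \<open>i < k\<close> fixes
      their order.\<close>
    proof (rule double[OF s d, of i k])
      fix i' j' k' l' T'
      assume "normal (Double i' j' k' l' T')" and e: "{#i', j', k', l'#} + T' = d"
        and nz: "coeff2 i k (Double i' j' k' l' T') \<noteq> 0"
      then have n': "j' = heavy d" "l' = heavy d" "i' < k'" "i' \<noteq> heavy d" "k' \<noteq> heavy d"
        using h unfolding normal.simps Let_def e by (simp_all split: if_splits)
      with n nz show "i' = i \<and> j' = j \<and> k' = k \<and> l' = l"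
        by (auto simp: pair_ind_def split: if_splits)
    qed (use n sub in \<open>simp_all add: pair_ind_def\<close>)
  qed
  have light: "distinct [i, j, k, l] \<and> i = min1 d \<and> (k = min2 d \<and> j < l \<or> j = min2 d \<and> k = min3 d)"
    if "normal (Double i j k l T)" "{#i, j, k, l#} + T = d" "\<nexists>v. 2 \<le> count d v" for i j k l T d
  proof -
    have "\<not> 2 \<le> count d i" "\<not> 2 \<le> count d j" "\<not> 2 \<le> count d k" "\<not> 2 \<le> count d l"
      using that(3) by auto
    then have "distinct [i, j, k, l]" by (auto simp: that(2)[symmetric] split: if_splits)
    with that show ?thesis unfolding normal.simps Let_def that(2) by auto
  qed
  have light1: "c (Double i j k l T) = 0"
    if s: "Double i j k l T \<in> W" and d: "{#i, j, k, l#} + T = d" and h: "\<nexists>v. 2 \<le> count d v"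
      and k: "k = min2 d" "j < l" for i j k l T d
  proof -
    note n = light[OF W[OF s] d h]
    have sub: "{#j, l#} \<subseteq># d" unfolding d[symmetric] by simp
    show ?thesis
    \<comment> \<open>Both letters differ from \<open>min1 d\<close> and \<open>min2 d\<close>,
      whereas every pair taken from the brackets of a word of the second kind contains one of
      these.\<close>
    proof (rule double[OF s d[symmetric], of j l])
      fix i' j' k' l' T'
      assume "normal (Double i' j' k' l' T')" and "{#i', j', k', l'#} + T' = d"
        and nz: "coeff2 j l (Double i' j' k' l' T') \<noteq> 0"
      note n' = light[OF this(1,2) h]
      with n nz k show "i' = i \<and> j' = j \<and> k' = k \<and> l' = l"
        by (auto simp: pair_ind_def split: if_splits)
    qed (use n k sub in \<open>auto simp: pair_ind_def\<close>)
  qed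
  have light2: "c (Double i j k l T) = 0"
    if s: "Double i j k l T \<in> W" and d: "{#i, j, k, l#} + T = d" and h: "\<nexists>v. 2 \<le> count d v"
      and k: "j = min2 d" "k = min3 d" for i j k l T d
  proof -
    note n = light[OF W[OF s] d h]
    have sub: "{#i, l#} \<subseteq># d" unfolding d[symmetric] by simp
    show ?thesis
    \<comment> \<open>Here \<open>i\<close> is \<open>min1 d\<close>. Words of the first kind can
      also contribute to this pair, but \<open>light1\<close> has eliminated them.\<close>
    proof (rule double[OF s d[symmetric], of i l])
      fix i' j' k' l' T'
      assume s': "Double i' j' k' l' T' \<in> W" "normal (Double i' j' k' l' T')"
          "{#i', j', k', l'#} + T' = d" "c (Double i' j' k' l' T') \<noteq> 0"
        and nz: "coeff2 i l (Double i' j' k' l' T') \<noteq> 0"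
      note n' = light[OF s'(2,3) h]
      have "\<not> (k' = min2 d \<and> j' < l')" using light1[OF s'(1,3) h] s'(4) by blast
      with n n' nz k show "i' = i \<and> j' = j \<and> k' = k \<and> l' = l"
        by (auto simp: pair_ind_def split: if_splits)
    qed (use n k sub in \<open>auto simp: pair_ind_def\<close>)
  qed
  show ?thesis
  proof (cases w0)
    case (Double i j k l T)
    define d where "d = {#i, j, k, l#} + T"
    show ?thesis
    proof (cases "\<exists>v. 2 \<le> count d v")
      case True
      with heavy[of i j k l T d] Double w0 show ?thesis by (simp add: d_def)
    next
      case False
      with light[of i j k l T d] light1[of i j k l T d] light2[of i j k l T d] Double w0 W[OF w0]
      show ?thesis by (metis d_def)
    qed
  qed (use w0 gen single in auto)
qed

end

section \<open>The relatively free algebra\<close>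

context lie_algebra
begin

section \<open>Evaluation of products and substitutions\<close>

lemma eval_hom:
  "eval v (f + g) = eval v f + eval v g"
  "eval v (fscale r f) = scale r (eval v f)"
  "eval v (f \<odot> g) = br (eval v f) (eval v g)"
  using lie_hom_eval[of v] by (simp_all add: lie_hom_def)

lemma eval_zero: "eval v 0 = 0"
  using eval_hom(1)[of v 0 0] by simp

lemma eval_sum: "eval v (sum f S) = (\<Sum>x\<in>S. eval v (f x))"
  by (induction S rule: infinite_finite_induct) (simp_all add: eval_zero eval_hom)

lemma eval_foldl: "eval v (foldl (\<odot>) f fs) = foldl br (eval v f) (map (eval v) fs)"
  by (induction fs arbitrary: f) (simp_all add: eval_hom)

lemma eval_lprod_gen:
  assumes "is \<noteq> []" "0 \<notin> set is"
  shows "eval v (free.lprod (map gen is)) = lprod (map v is)"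
proof -
  have "\<forall>i\<in>set is. eval v (gen i) = v i"
    using assms(2) by (intro ballI eval_gen) (metis less_one not_less)
  with assms(1) show ?thesis
    by (cases "is") (simp_all add: free.lprod_def lprod_def eval_foldl comp_def cong: map_cong)
qed

lemma eval_word_val: "eval v (word_val (\<odot>) y w) = word_val br (\<lambda>i. eval v (y i)) w"
  by (cases w) (simp_all add: eval_foldl eval_hom comp_def)

lemma eval_subst: "eval v (free.eval g f) = eval (\<lambda>i. eval v (g i)) f"
proof -
  have "lie_hom fscale (\<odot>) scale br (\<lambda>f. eval v (free.eval g f))"
    by (simp add: lie_hom_def eval_hom free.eval_hom)
  from eval_unique[OF this, of "\<lambda>i. eval v (g i)"] show ?thesis
    by (metis free.eval_gen)
qed

lemma T_ideal_identities: "T_ideal identities"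
  by (auto simp: T_ideal_def free.lie_ideal_def free.subspace_def identities_def
      eval_hom eval_zero eval_subst)

end

section \<open>The basis as axioms of a model\<close>

definition gl2_basis :: "'f::field free_lie set" where
  "gl2_basis = {(gen 1 \<odot> gen 2) \<odot> (gen 3 \<odot> gen 4) \<odot> gen 5}
      \<union> {(gen 1 \<odot> gen 2) \<odot> free.lprod (map gen [1..<Suc k]) | k. k > 2}
      \<union> {(gen 1 \<odot> gen 2) \<odot> (gen 3 \<odot> gen 4)
         + (gen 1 \<odot> gen 3) \<odot> (gen 2 \<odot> gen 4)
         + (gen 1 \<odot> gen 4) \<odot> (gen 2 \<odot> gen 3)}
      \<union> {(gen 1 \<odot> gen 2) \<odot> free.lprod (map gen ([3, 4] @ [5..<Suc m]))
         + (gen 1 \<odot> gen 3) \<odot> free.lprod (map gen ([2, 4] @ [5..<Suc m]))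
         + (gen 1 \<odot> gen 4) \<odot> free.lprod (map gen ([2, 3] @ [5..<Suc m])) | m. m > 4}"

lemma upt_1_2: "2 < k \<Longrightarrow> [1..<Suc k] = 1 # 2 # [3..<Suc k]"
  by (simp add: upt_conv_Cons numeral_eq_Suc del: upt_Suc)

text \<open>For evaluation at a point given by a list: generators are numbered from 1 and list
  positions from 0, hence \<open>i - 1\<close>.\<close>

lemma map_upt_nth:
  "map (\<lambda>i. (us @ xs) ! (i - 1)) [Suc (length us)..<Suc (length us + length xs)] = xs"
  by (rule nth_equalityI) (simp_all add: nth_append del: upt_Suc)

context lie_algebra
begin

lemma eval_lprod_two_gens:
  assumes "0 < i" "0 < j" "0 \<notin> set is"
  shows "eval v (free.lprod (map gen (i # j # is))) = foldl br (br (v i) (v j)) (map v is)"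
  using assms by (subst eval_lprod_gen) (simp_all add: lprod_def)

lemma (in gl2_like) basis_subset_identities: "gl2_basis \<subseteq> identities"
proof -
  have "eval v f = 0" if "f \<in> gl2_basis" for v f
    using that alternating exchange[of _ _ _ _ "[]"] exchange derived2_central unfolding gl2_basis_def
    by (auto simp: eval_hom eval_gen eval_lprod_two_gens upt_1_2 simp del: upt_Suc list.map One_nat_def)
  then show ?thesis by (auto simp: identities_def)
qed

text \<open>Each axiom is the value of a basis element at the listed arguments; the length of
  \<open>xs\<close> selects the member of the families (b) and (d).\<close>

lemma gl2_like_if_basis_identities:
  assumes two: "\<And>x :: 'b. x + x = 0" and basis: "gl2_basis \<subseteq> identities"
  shows "gl2_like scale br"
proof
  have eval: "eval v f = 0" if "f \<in> gl2_basis" for v f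
    using basis that by (auto simp: identities_def)
  fix a b c d e :: 'b and xs :: "'b list"
  show "a + a = 0" by (rule two)
  have "eval (\<lambda>i. [a, b, c, d, e] ! (i - 1)) ((gen 1 \<odot> gen 2) \<odot> (gen 3 \<odot> gen 4) \<odot> gen 5) = 0"
    by (rule eval) (simp add: gl2_basis_def)
  then show "br (br (br a b) (br c d)) e = 0"
    by (simp add: eval_hom eval_gen)
  show "br (br a b) (foldl br (br a b) xs) = 0"
  proof (cases "xs = []")
    case False
    let ?v = "\<lambda>i. ([a, b] @ xs) ! (i - 1)" and ?k = "2 + length xs"
    have k: "2 < ?k" using False by simp
    have "eval ?v ((gen 1 \<odot> gen 2) \<odot> free.lprod (map gen [1..<Suc ?k])) = 0"
      by (rule eval) (use k in \<open>unfold gl2_basis_def, blast\<close>)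
    then show ?thesis
      using map_upt_nth[of "[a, b]" xs] unfolding upt_1_2[OF k]
      by (simp add: eval_hom eval_gen eval_lprod_two_gens numeral_eq_Suc del: upt_Suc list.map)
  qed (simp add: br_self)
  show "br (br a b) (foldl br (br c d) xs) + br (br a c) (foldl br (br b d) xs)
      + br (br a d) (foldl br (br b c) xs) = 0"
  proof (cases "xs = []")
    case True
    have "eval (\<lambda>i. [a, b, c, d] ! (i - 1)) ((gen 1 \<odot> gen 2) \<odot> (gen 3 \<odot> gen 4)
         + (gen 1 \<odot> gen 3) \<odot> (gen 2 \<odot> gen 4)
         + (gen 1 \<odot> gen 4) \<odot> (gen 2 \<odot> gen 3)) = 0"
      by (rule eval) (simp add: gl2_basis_def)
    with True show ?thesis by (simp add: eval_hom eval_gen)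
  next
    case False
    let ?v = "\<lambda>i. ([a, b, c, d] @ xs) ! (i - 1)" and ?m = "4 + length xs"
    have m: "4 < ?m" using False by simp
    have "eval ?v ((gen 1 \<odot> gen 2) \<odot> free.lprod (map gen ([3, 4] @ [5..<Suc ?m]))
         + (gen 1 \<odot> gen 3) \<odot> free.lprod (map gen ([2, 4] @ [5..<Suc ?m]))
         + (gen 1 \<odot> gen 4) \<odot> free.lprod (map gen ([2, 3] @ [5..<Suc ?m]))) = 0"
      by (rule eval) (use m in \<open>unfold gl2_basis_def, blast\<close>)
    then show ?thesis
      using map_upt_nth[of "[a, b, c, d]" xs]
      by (simp add: eval_hom eval_gen eval_lprod_two_gens numeral_eq_Suc del: upt_Suc list.map)
  qed
qed

end

lemma gl2_like_gl2:
  assumes char2: "CHAR('f::field) = 2"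
  shows "gl2_like mscale (commutator :: 'f^2^2 \<Rightarrow> _)"
proof
  have zeroI: "A = 0" if "A $ 1 $ 1 = 0" "A $ 1 $ 2 = 0" "A $ 2 $ 1 = 0" "A $ 2 $ 2 = 0" for A :: "'f^2^2"
    using that by (simp add: vec_eq_iff forall_2)
  note diag = commutator_diag[OF char2] and dbl = double_commutator_nth[OF char2]
    and simps = char2_minus[OF char2] char2_two[OF char2]
  fix A B C D E :: "'f^2^2" and xs :: "('f^2^2) list"
  have two: "x + x = 0" for x :: 'f using char2_two[OF char2] by (metis mult_2 mult_zero_left)
  show "A + A = 0" by (rule zeroI) (simp_all only: vector_add_component two)
  show "commutator (commutator (commutator A B) (commutator C D)) E = 0"
    using dbl(1,2)[of A B C D "[]"] diag[of "commutator A B" "commutator C D"]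
    by (intro zeroI) (simp_all add: commutator_nth(1-4)[of _ E] algebra_simps)
  show "commutator (commutator A B) (foldl commutator (commutator A B) xs) = 0"
    by (rule zeroI) (simp_all add: diag dbl two mult.commute)
  show "commutator (commutator A B) (foldl commutator (commutator C D) xs)
      + commutator (commutator A C) (foldl commutator (commutator B D) xs)
      + commutator (commutator A D) (foldl commutator (commutator B C) xs) = 0"
  proof (rule zeroI)
    let ?s = "commutator (commutator A B) (foldl commutator (commutator C D) xs)
      + commutator (commutator A C) (foldl commutator (commutator B D) xs)
      + commutator (commutator A D) (foldl commutator (commutator B C) xs)"
    \<comment> \<open>The tail is a common factor. Each choice of two letters supplying the
      off-diagonal entries occurs in two of the three pairings, so the rest cancels.\<close>
    show "?s $ 1 $ 1 = 0"
      by (simp add: dbl flip: distrib_right)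
         (simp add: commutator_nth simps algebra_simps)
    then show "?s $ 2 $ 2 = 0" by (simp add: diag)
  qed (simp_all add: dbl)
qed

section \<open>The quotient by the T-ideal of the basis\<close>

lemma subspace_T_ideal_hull: "free.subspace (T_ideal hull S)"
  using T_ideal_hull[of S] by (simp add: T_ideal_def free.lie_ideal_def)

lemma T_ideal_hull_br:
  assumes "f \<in> T_ideal hull S" shows "f \<odot> g \<in> T_ideal hull S" "g \<odot> f \<in> T_ideal hull S"
  using T_ideal_hull[of S] assms by (simp_all add: T_ideal_def free.lie_ideal_def)

lemma T_ideal_hull_eval: "f \<in> T_ideal hull S \<Longrightarrow> free.eval g f \<in> T_ideal hull S"
  using T_ideal_hull[of S] by (simp add: T_ideal_def)

\<comment> \<open>The relatively free algebra, made a type so that it can be an instance of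
  \<open>gl2_like\<close> and inherit the spanning result.\<close>
quotient_type (overloaded) 'f rel_free =
  "'f::field free_lie" / "\<lambda>f g. f - g \<in> T_ideal hull gl2_basis"
proof (intro equivpI reflpI sympI transpI)
  fix f g h :: "'f free_lie"
  show "f - f \<in> T_ideal hull gl2_basis"
    by (simp add: free.subspace_0[OF subspace_T_ideal_hull])
  show "g - f \<in> T_ideal hull gl2_basis" if "f - g \<in> T_ideal hull gl2_basis"
    using free.subspace_neg[OF subspace_T_ideal_hull that] by simp
  show "f - h \<in> T_ideal hull gl2_basis"
    if "f - g \<in> T_ideal hull gl2_basis" "g - h \<in> T_ideal hull gl2_basis"
    using free.subspace_add[OF subspace_T_ideal_hull that] by simp
qed

instantiation rel_free :: (field) ab_group_add
begin

lift_definition zero_rel_free :: "'a rel_free" is 0 .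

lift_definition plus_rel_free :: "'a rel_free \<Rightarrow> 'a rel_free \<Rightarrow> 'a rel_free" is "(+)"
  by (drule (1) free.subspace_add[OF subspace_T_ideal_hull]) (simp add: algebra_simps)

lift_definition uminus_rel_free :: "'a rel_free \<Rightarrow> 'a rel_free" is uminus
  by (drule free.subspace_neg[OF subspace_T_ideal_hull]) simp

definition minus_rel_free :: "'a rel_free \<Rightarrow> 'a rel_free \<Rightarrow> 'a rel_free" where
  "minus_rel_free a b = a + - b"

instance
  by standard
    (simp add: minus_rel_free_def
      | (transfer, simp add: algebra_simps free.subspace_0[OF subspace_T_ideal_hull]))+

end

lift_definition rscale :: "'f::field \<Rightarrow> 'f rel_free \<Rightarrow> 'f rel_free" is fscale
  by (metis free.scale_right_diff_distrib free.subspace_scale[OF subspace_T_ideal_hull])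

lift_definition rbr :: "'f::field rel_free \<Rightarrow> 'f rel_free \<Rightarrow> 'f rel_free" is fbr
proof -
  fix f f' g g' :: "'f free_lie"
  assume "f - f' \<in> T_ideal hull gl2_basis" "g - g' \<in> T_ideal hull gl2_basis"
  then have "(f - f') \<odot> g + f' \<odot> (g - g') \<in> T_ideal hull gl2_basis"
    by (intro free.subspace_add[OF subspace_T_ideal_hull] T_ideal_hull_br)
  moreover have "(f - f') \<odot> g + f' \<odot> (g - g') = f \<odot> g - f' \<odot> g'"
    using free.br_add_left[of "f - f'" f' g] free.br_add_right[of f' "g - g'" g'] by simp
  ultimately show "f \<odot> g - f' \<odot> g' \<in> T_ideal hull gl2_basis" by simp
qed

global_interpretation rel: lie_algebra rscale "rbr :: 'f::field rel_free \<Rightarrow> _"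
proof
  have sub0: "f = g \<Longrightarrow> f - g \<in> T_ideal hull gl2_basis" for f g :: "'f free_lie"
    by (simp add: free.subspace_0[OF subspace_T_ideal_hull])
  fix q r :: 'f and a b c :: "'f rel_free"
  show "rscale r (a + b) = rscale r a + rscale r b"
    by transfer (rule sub0, rule free.scale_right_distrib)
  show "rscale (q + r) a = rscale q a + rscale r a"
    by transfer (rule sub0, rule free.scale_left_distrib)
  show "rscale q (rscale r a) = rscale (q * r) a" by transfer (rule sub0, simp)
  show "rscale 1 a = a" by transfer (rule sub0, simp)
  show "rbr (a + b) c = rbr a c + rbr b c" by transfer (rule sub0, rule free.br_add_left)
  show "rbr a (b + c) = rbr a b + rbr a c" by transfer (rule sub0, rule free.br_add_right)
  show "rbr (rscale r a) b = rscale r (rbr a b)" by transfer (rule sub0, rule free.br_scale_left)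
  show "rbr a (rscale r b) = rscale r (rbr a b)" by transfer (rule sub0, rule free.br_scale_right)
  show "rbr a a = 0" by transfer (rule sub0, rule free.br_self)
  show "rbr a (rbr b c) + rbr b (rbr c a) + rbr c (rbr a b) = 0"
    by transfer (rule sub0, rule free.jacobi)
qed

lemma abs_rel_free_eq_0_iff: "abs_rel_free f = 0 \<longleftrightarrow> f \<in> T_ideal hull gl2_basis"
  unfolding zero_rel_free.abs_eq rel_free.abs_eq_iff by simp

lemma abs_rel_free_eval: "abs_rel_free (free.eval g f) = rel.eval (\<lambda>i. abs_rel_free (g i)) f"
proof -
  have "lie_hom fscale (\<odot>) rscale rbr (\<lambda>f. abs_rel_free (free.eval g f))"
    by (simp add: lie_hom_def free.eval_hom plus_rel_free.abs_eq rscale.abs_eq rbr.abs_eq)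
  from rel.eval_unique[OF this, of "\<lambda>i. abs_rel_free (g i)"] show ?thesis
    by (metis free.eval_gen)
qed

lemma free_eval_gen_id: "free.eval gen f = f"
proof -
  have "lie_hom fscale (\<odot>) fscale (\<odot>) (\<lambda>f. f)" by (simp add: lie_hom_def)
  from free.eval_unique[OF this, of gen] show ?thesis by metis
qed

text \<open>Every point of the quotient lifts to a substitution in the free algebra, and the T-ideal
  is stable under substitutions.\<close>

lemma basis_subset_rel_identities: "gl2_basis \<subseteq> rel.identities"
proof
  fix f :: "'f::field free_lie" assume f: "f \<in> gl2_basis"
  have "rel.eval v f = 0" for v
  proof -
    have v: "v = (\<lambda>i. abs_rel_free (rep_rel_free (v i)))"
      using Quotient_abs_rep[OF Quotient_rel_free] by metis
    have "free.eval (\<lambda>i. rep_rel_free (v i)) f \<in> T_ideal hull gl2_basis"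
      using f by (intro T_ideal_hull_eval hull_inc)
    then show ?thesis
      unfolding abs_rel_free_eq_0_iff[symmetric] abs_rel_free_eval using v by metis
  qed
  then show "f \<in> rel.identities" by (simp add: rel.identities_def)
qed

lemma gl2_like_rel:
  assumes "CHAR('f::field) = 2"
  shows "gl2_like rscale (rbr :: 'f rel_free \<Rightarrow> _)"
proof (rule rel.gl2_like_if_basis_identities[OF _ basis_subset_rel_identities])
  fix x :: "'f rel_free"
  have "x + x = rscale (1 + 1) x" by (simp only: rel.scale_left_distrib rel.scale_one)
  then show "x + x = 0" using char2_two[OF assms] by simp
qed

lemma free_lie_normal_form:
  fixes f :: "'f::field free_lie"
  assumes "CHAR('f) = 2"
  obtains W c where "finite W" "W \<subseteq> Collect normal"
    "f - (\<Sum>w\<in>W. fscale (c w) (word_val (\<odot>) (\<lambda>i. gen (Suc i)) w)) \<in> T_ideal hull gl2_basis"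
proof -
  interpret gl2_like rscale "rbr :: 'f rel_free \<Rightarrow> _" by (rule gl2_like_rel) fact
  define v where "v = (\<lambda>i. abs_rel_free (gen i :: 'f free_lie))"
  let ?val = "word_val rbr (\<lambda>i. v (Suc i))"
  have ev: "abs_rel_free g = rel.eval v g" for g
    using abs_rel_free_eval[of gen g] by (simp add: free_eval_gen_id v_def)
  obtain t where t: "f = abs_free_lie t" by (induction f) blast
  have "abs_rel_free f \<in> normal_span (\<lambda>i. v (Suc i))"
    unfolding ev t rel.eval_abs by (rule term_eval_normal)
  then obtain U r where U: "finite U" "U \<subseteq> ?val ` Collect normal"
      "abs_rel_free f = (\<Sum>u\<in>U. rscale (r u) u)"
    unfolding normal_span_def rel.span_explicit by auto
  \<comment> \<open>Distinct words may have equal values in the quotient, so \<open>W\<close> picks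
    one word for each value in \<open>U\<close>.\<close>
  from U(1,2) obtain W where W: "W \<subseteq> Collect normal" "finite W" "inj_on ?val W" "U = ?val ` W"
    unfolding subset_image_inj by (metis finite_imageD)
  have "abs_rel_free f = (\<Sum>w\<in>W. rscale (r (?val w)) (?val w))"
    using W U(3) by (simp add: sum.reindex)
  also have "\<dots> = rel.eval v (\<Sum>w\<in>W. fscale (r (?val w)) (word_val (\<odot>) (\<lambda>i. gen (Suc i)) w))"
    by (simp add: rel.eval_sum rel.eval_hom rel.eval_word_val rel.eval_gen)
  finally have "f - (\<Sum>w\<in>W. fscale (r (?val w)) (word_val (\<odot>) (\<lambda>i. gen (Suc i)) w))
      \<in> T_ideal hull gl2_basis"
    by (simp only: rel_free.abs_eq_iff flip: ev)
  from that[OF W(2,1) this] show thesis .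
qed

text \<open>Modulo the T-ideal an identity is a combination of normal words. This combination
  vanishes on \<open>gl2\<close> too, so independence makes all its coefficients zero.\<close>

lemma gl2_identities_eq:
  assumes inf: "infinite (UNIV :: 'f::field set)" and char2: "CHAR('f) = 2"
  shows "(gl2.identities :: 'f free_lie set) = T_ideal hull gl2_basis"
proof
  interpret gl2_like mscale "commutator :: 'f^2^2 \<Rightarrow> _" by (rule gl2_like_gl2) fact
  show sound: "T_ideal hull gl2_basis \<subseteq> (gl2.identities :: 'f free_lie set)"
    by (rule hull_minimal) (rule basis_subset_identities, rule gl2.T_ideal_identities)
  show "(gl2.identities :: 'f free_lie set) \<subseteq> T_ideal hull gl2_basis"
  proof
    fix f :: "'f free_lie" assume f: "f \<in> gl2.identities"
    obtain W c where W: "finite W" "W \<subseteq> Collect normal"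
      and nf: "f - (\<Sum>w\<in>W. fscale (c w) (word_val (\<odot>) (\<lambda>i. gen (Suc i)) w)) \<in> T_ideal hull gl2_basis"
      using free_lie_normal_form[OF char2, of f] by blast
    let ?g = "\<Sum>w\<in>W. fscale (c w) (word_val (\<odot>) (\<lambda>i. gen (Suc i)) w)"
    have "(\<Sum>w\<in>W. mscale (c w) (word_val commutator y w)) = 0" for y
    proof -
      \<comment> \<open>Letter \<open>i\<close> of a word stands for \<open>gen (Suc i)\<close>, so
        this point gives it the value \<open>y i\<close>.\<close>
      let ?v = "\<lambda>i. y (i - 1)"
      have "gl2.eval ?v f = gl2.eval ?v (f - ?g) + gl2.eval ?v ?g"
        by (simp flip: gl2.eval_hom(1))
      moreover have "gl2.eval ?v f = 0" "gl2.eval ?v (f - ?g) = 0"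
        using f sound nf by (auto simp: gl2.identities_def)
      ultimately have "gl2.eval ?v ?g = 0" by simp
      then show ?thesis
        by (simp add: gl2.eval_sum gl2.eval_hom gl2.eval_word_val gl2.eval_gen)
    qed
    then have "c w = 0" if "w \<in> W" for w
      using normal_words_independent[OF char2 inf W(1)] W(2) that by blast
    then have "?g = 0" by simp
    with nf show "f \<in> T_ideal hull gl2_basis" by simp
  qed
qed

theorem theorem1p1:
  assumes "infinite (UNIV :: 'f::field set)"
    and "CHAR('f) = 2"
  shows "(gl2.identities :: 'f free_lie set) =
    T_ideal hull
     ({(gen 1 \<odot> gen 2) \<odot> (gen 3 \<odot> gen 4) \<odot> gen 5}
      \<union> {(gen 1 \<odot> gen 2) \<odot> free.lprod (map gen [1..<Suc k]) | k. k > 2}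
      \<union> {(gen 1 \<odot> gen 2) \<odot> (gen 3 \<odot> gen 4)
         + (gen 1 \<odot> gen 3) \<odot> (gen 2 \<odot> gen 4)
         + (gen 1 \<odot> gen 4) \<odot> (gen 2 \<odot> gen 3)}
      \<union> {(gen 1 \<odot> gen 2) \<odot> free.lprod (map gen ([3, 4] @ [5..<Suc m]))
         + (gen 1 \<odot> gen 3) \<odot> free.lprod (map gen ([2, 4] @ [5..<Suc m]))
         + (gen 1 \<odot> gen 4) \<odot> free.lprod (map gen ([2, 3] @ [5..<Suc m])) | m. m > 4})"
  using gl2_identities_eq[OF assms] unfolding gl2_basis_def .

end
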